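(* Let $0<\lambda,\alpha\le 1$. Let $\sigma_0\in\mathbb R$ and $\operatorname{Re} s\ge\sigma_0$. Let $L(\lambda,\alpha,s)\ne 0$ and let $d$ be the distance from $s$ to the nearest zero of $L(\lambda,\alpha,\cdot)$. Then $$\frac{1}{|L(\lambda,\alpha,s)|}<\exp\bigl(C(|\log d|+1)\log t\bigr),$$ where $C=C(\lambda,\alpha,\sigma_0)$ is a positive constant.
   Context: Here $s=\sigma+it$ is a complex variable with real part $\sigma$ and imaginary part $t$, and $\lambda$ and $\alpha$ are fixed constants. For $0<\lambda,\alpha\le 1$ the Lerch zeta-function is given by $L(\lambda,\alpha,s)=\sum_{m=0}^\infty \frac{e^{2\pi i\lambda m}}{(m+\alpha)^s}$ for $\sigma>1$, and by analytic continuation to the whole complex plane except for a possible simple pole at $s=1$.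
   Formalization: The bound is stated for t ≥ t_0 with an arbitrary fixed t_0 > 1, and C may also depend on t_0; without this it fails as t → 1+ (e.g. λ = α = 1, s = 1/2 + it, where |ζ(1/2+i)| < 1), and log t is undefined for t ≤ 0. *)

theory Defs
  imports "HOL-Complex_Analysis.Complex_Analysis"
begin

text \<open>
  The conditions determine the function uniquely: a nicely meromorphic function is continuous at
  every point that is not a pole and takes the value 0 at its poles.
\<close>

definition lerch_zeta :: "real \<Rightarrow> real \<Rightarrow> complex \<Rightarrow> complex" where
  "lerch_zeta lam \<alpha> = (THE f.
     f nicely_meromorphic_on UNIV \<and>
     (\<forall>z. is_pole f z \<longrightarrow> z = 1 \<and> zorder f z = -1) \<and>
     (\<forall>s. Re s > 1 \<longrightarrow>
        (\<lambda>m. exp (2 * of_real pi * \<i> * of_real lam * of_nat m) / of_real (real m + \<alpha>) powr s)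
          sums f s))"

text \<open>
  A pole, where the value 0 is a mere convention, is not a zero.
\<close>

definition lerch_zeros :: "real \<Rightarrow> real \<Rightarrow> complex set" where
  "lerch_zeros lam \<alpha> = {z. lerch_zeta lam \<alpha> z = 0 \<and> \<not> is_pole (lerch_zeta lam \<alpha>) z}"

end

theory Submission
  imports Defs
begin

text \<open>
  With \<open>L\<close> the Lerch zeta function, \<open>H s = (s - 1) * L s\<close> is entire and bounded by a power of
  \<open>1 + norm s\<close> on vertical strips: Taylor expansion of \<open>x powr (-s)\<close> between consecutive
  terms of the series expresses \<open>L s\<close> by \<open>L (s + 1), L (s + 2), \<dots>\<close> and a remainder series
  that converges further to the left.  Centre a disc of fixed radius at \<open>\<sigma> + i t\<close>, where \<open>\<sigma>\<close> is so large
  that the first term of the series dominates.  There \<open>H\<close> has \<open>O(ln t)\<close> zeros; dividing them out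
  leaves a zero-free function, which by the Borel-Caratheodory argument is at least a negative power of
  \<open>t\<close>, and each removed zero costs a factor of at least a constant times \<open>min d 1\<close>.
\<close>

subsection \<open>Lower bounds away from the zeros\<close>

text \<open>Everything is controlled by one number \<open>M\<close>, a bound for the quotient of
  \<open>H\<close> on the large disc by its value at the centre: the number of removed zeros and the
  loss in the zero-free part are both bounded through \<open>ln M\<close>, and \<open>ln M\<close>
  is \<open>O(ln t)\<close> because \<open>H\<close> grows polynomially.

  The radii \<open>R\<close>, \<open>2 * R\<close>, \<open>5 * R\<close> keep the count of zeros
  elementary. A zero in the middle disc lies within \<open>2 * R\<close> of the centre but at least
  \<open>3 * R\<close> from the outer circle, and this ratio \<open>3/2\<close> replaces Jensen's
  formula. The lower bound is wanted only in the smallest disc, half as wide as the zero-free one,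
  so the Schwarz lemma costs no more than the fixed power \<open>M ^ 4\<close>.

  The factor \<open>s - 1\<close> lets the discs contain the point 1 without a case distinction. The
  continuation meets one obstacle: for \<omega> = 1 the coefficient \<open>1 - \<omega>\<close> of
  the leading term of the recurrence vanishes, so that the next term has to be solved for
  instead.\<close>

lemma nonvanishing_lower_bound:
  fixes g :: "complex \<Rightarrow> complex"
  assumes holg: "g holomorphic_on ball z0 (2 * R)" and R: "R > 0" and M: "M > 1"
    and nz: "\<And>w. w \<in> ball z0 (2 * R) \<Longrightarrow> g w \<noteq> 0"
    and bd: "\<And>w. w \<in> ball z0 (2 * R) \<Longrightarrow> norm (g w) \<le> M * norm (g z0)"
    and z: "z \<in> cball z0 R"
  shows "norm (g z0) \<le> M ^ 4 * norm (g z)"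
proof -
  obtain h where holh: "h holomorphic_on ball z0 (2 * R)"
    and h: "\<And>w. w \<in> ball z0 (2 * R) \<Longrightarrow> exp (h w) = g w"
    using holomorphic_logarithm_exists[of "ball z0 (2 * R)" g z0] holg nz R by auto
  \<comment> \<open>Any value strictly above \<open>ln M\<close> would do; the Schwarz lemma needs the strict bound on \<open>Re k\<close>.\<close>
  define A where "A = 2 * ln M"
  have A: "A > ln M" "A > 0" using M by (auto simp: A_def)
  have z0: "z0 \<in> ball z0 (2 * R)" using R by simp
  \<comment> \<open>The logarithm of \<open>g\<close> relative to its value at the centre, rescaled
    to the unit disc: \<open>k 0 = 0\<close>, and the bound on \<open>g\<close> becomes a bound on
    \<open>Re k\<close>.\<close>
  define k where "k u = h (z0 + of_real (2 * R) * u) - h z0" for u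
  have inb: "z0 + of_real (2 * R) * u \<in> ball z0 (2 * R)" if "u \<in> ball 0 1" for u
    using that R by (simp add: dist_norm norm_mult)
  have holk: "k holomorphic_on ball 0 1"
    unfolding k_def
    by (intro holomorphic_intros holomorphic_on_compose_gen[OF _ holh, unfolded o_def])
       (use inb in auto)
  have Rek: "Re (k u) < A" if u: "u \<in> ball 0 1" for u
  proof -
    have "exp (Re (k u)) = norm (g (z0 + of_real (2 * R) * u)) / norm (g z0)"
      using h[OF inb[OF u]] h[OF z0]
      by (metis Re_complex_of_real exp_diff k_def norm_divide norm_exp_eq_Re)
    also have "\<dots> \<le> M" using bd[OF inb[OF u]] nz[OF z0] by (simp add: field_simps)
    finally show ?thesis using A(1) M by (metis exp_gt_zero less_le_trans ln_exp ln_le_cancel_iff order_le_less_trans)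
  qed
  \<comment> \<open>The map \<open>w / (2 * A - w)\<close> sends the half-plane
    \<open>Re w < A\<close> into the unit disc and fixes 0, which is the situation of the Schwarz
    lemma.\<close>
  define p where "p u = k u / (of_real (2 * A) - k u)" for u
  have den: "norm (k u) < norm (of_real (2 * A) - k u)" if u: "u \<in> ball 0 1" for u
  proof -
    have "(Re (k u))\<^sup>2 < (2 * A - Re (k u))\<^sup>2"
    proof -
      have "0 < 4 * A * (A - Re (k u))" using Rek[OF u] A by simp
      thus ?thesis by (simp add: power2_eq_square algebra_simps)
    qed
    thus ?thesis unfolding cmod_def by simp
  qed
  have holp: "p holomorphic_on ball 0 1"
    unfolding p_def by (intro holomorphic_intros holk) (use den in force)
  have p0: "p 0 = 0" by (simp add: p_def k_def)
  have p1: "norm (p u) < 1" if "norm u < 1" for u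
    using den[of u] that by (simp add: p_def norm_divide divide_simps)
  define u where "u = (z - z0) / of_real (2 * R)"
  have nu: "norm u \<le> 1 / 2" using z R by (simp add: u_def norm_divide dist_norm norm_minus_commute field_simps)
  have "norm (p u) \<le> norm u"
    using Schwarz_Lemma(1)[OF holp p0 p1] nu by simp
  hence "norm (p u) \<le> 1 / 2" using nu by simp
  \<comment> \<open>Clearing the denominator leads to
    \<open>norm (k u) \<le> 2 * A = 4 * ln M\<close>; this is where the exponent 4 comes
    from.\<close>
  hence "2 * norm (k u) \<le> norm (of_real (2 * A) - k u)"
    using den[of u] nu by (auto simp: p_def norm_divide divide_simps split: if_splits)
  also have "\<dots> \<le> 2 * A + norm (k u)"
    using norm_triangle_ineq4[of "of_real (2 * A)" "k u"] A by simp
  finally have "norm (k u) \<le> 2 * A" by simp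
  hence "- (2 * A) \<le> Re (k u)" using abs_Re_le_cmod[of "k u"] by linarith
  hence "exp (- (2 * A)) \<le> exp (Re (k u))" by simp
  also have zu: "z0 + of_real (2 * R) * u = z" using R by (simp add: u_def)
  have zb: "z \<in> ball z0 (2 * R)" using z R by simp
  have "exp (Re (k u)) = norm (g z) / norm (g z0)"
    using h[OF zb] h[OF z0] zu
    by (metis exp_diff k_def norm_divide norm_exp_eq_Re)
  finally have "exp (- (2 * A)) * norm (g z0) \<le> norm (g z)"
    using nz[OF z0] by (simp add: field_simps)
  moreover have "exp (2 * A) = M ^ 4"
    using M by (simp add: A_def exp_of_nat_mult[of 4, simplified])
  ultimately show ?thesis by (simp add: exp_minus field_simps)
qed

text \<open>Each removed factor \<open>w - r\<close> has modulus at least \<open>3 * R\<close> on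
  the outer circle and at most \<open>2 * R\<close> at the centre. By the maximum principle every
  division therefore improves the bound for \<open>g\<close> relative to \<open>g z0\<close> by a
  factor \<open>2/3\<close>. At the centre itself this relative bound cannot fall below 1, which
  caps the number of removed zeros.\<close>

lemma divided_zeros_bound:
  fixes f g :: "complex \<Rightarrow> complex"
  assumes S: "cball z0 (5 * R) \<subseteq> S" and holg: "g holomorphic_on S" and R: "R > 0"
    and fg: "\<And>w. w \<in> S \<Longrightarrow> f w = g w * (\<Prod>r\<leftarrow>rs. w - r)"
    and rs: "set rs \<subseteq> cball z0 (2 * R)"
    and f0: "f z0 \<noteq> 0"
    and bd: "\<And>w. w \<in> cball z0 (5 * R) \<Longrightarrow> norm (f w) \<le> M * norm (f z0)"
  shows "norm (f z0) \<le> (2 * R) ^ length rs * norm (g z0)"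
    and "w \<in> cball z0 (5 * R) \<Longrightarrow> norm (g w) \<le> M * (2/3) ^ length rs * norm (g z0)"
    and "(3/2) ^ length rs \<le> M"
proof -
  have upper: "norm (\<Prod>r\<leftarrow>rs. z - r) \<le> c ^ length rs"
    if "\<And>r. r \<in> set rs \<Longrightarrow> norm (z - r) \<le> c" "0 \<le> c" for z c and rs :: "complex list"
    using that by (induction rs) (auto simp: norm_mult intro!: mult_mono)
  have lower: "c ^ length rs \<le> norm (\<Prod>r\<leftarrow>rs. z - r)"
    if "\<And>r. r \<in> set rs \<Longrightarrow> c \<le> norm (z - r)" "0 \<le> c" for z c and rs :: "complex list"
    using that by (induction rs) (auto simp: norm_mult intro!: mult_mono)
  have z0S: "z0 \<in> S" using S R by auto
  have "norm (\<Prod>r\<leftarrow>rs. z0 - r) \<le> (2 * R) ^ length rs"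
    by (rule upper) (use rs R in \<open>auto simp: dist_norm\<close>)
  thus 1: "norm (f z0) \<le> (2 * R) ^ length rs * norm (g z0)"
    using fg[OF z0S] by (simp add: norm_mult mult.commute mult_left_mono)
  have M0: "M \<ge> 0"
  proof -
    have "0 \<le> M * norm (f z0)" using bd[of z0] R by (auto intro: order_trans[OF norm_ge_zero])
    thus ?thesis using f0 by (simp add: zero_le_mult_iff)
  qed
  have fr: "norm (g w) \<le> M * norm (f z0) / (3 * R) ^ length rs" if w: "w \<in> frontier (cball z0 (5 * R))" for w
  proof -
    have d: "dist z0 w = 5 * R" using w R by (simp add: frontier_cball)
    have "(3 * R) ^ length rs \<le> norm (\<Prod>r\<leftarrow>rs. w - r)"
    proof (rule lower)
      fix r assume "r \<in> set rs"
      hence "dist z0 r \<le> 2 * R" using rs by auto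
      thus "3 * R \<le> norm (w - r)" using d dist_triangle[of z0 w r] by (simp add: dist_norm norm_minus_commute)
    qed (use R in auto)
    moreover have "w \<in> S" using S d by auto
    ultimately have "norm (g w) * (3 * R) ^ length rs \<le> norm (f w)"
      by (simp add: fg norm_mult mult_left_mono)
    also have "\<dots> \<le> M * norm (f z0)" using bd d by simp
    finally show ?thesis using R by (simp add: field_simps)
  qed
  have gb: "norm (g w) \<le> M * norm (f z0) / (3 * R) ^ length rs" if w: "w \<in> cball z0 (5 * R)" for w
  proof (rule maximum_modulus_frontier[of g "cball z0 (5 * R)"])
    show "g holomorphic_on interior (cball z0 (5 * R))"
      using holg S by (meson holomorphic_on_subset interior_subset subset_trans)
    show "continuous_on (closure (cball z0 (5 * R))) g"
      using holg S by (metis closed_cball closure_closed holomorphic_on_imp_continuous_on holomorphic_on_subset)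
  qed (use fr w in auto)
  have gb2: "norm (g w) \<le> M * (2/3) ^ length rs * norm (g z0)" if w: "w \<in> cball z0 (5 * R)" for w
  proof -
    have "norm (g w) \<le> M * norm (f z0) / (3 * R) ^ length rs" by (rule gb[OF w])
    also have "\<dots> \<le> M * ((2 * R) ^ length rs * norm (g z0)) / (3 * R) ^ length rs"
      using 1 M0 R by (intro divide_right_mono mult_left_mono) auto
    also have "\<dots> = M * (2/3) ^ length rs * norm (g z0)"
      using R by (simp add: power_mult_distrib power_divide field_simps)
    finally show ?thesis .
  qed
  show "w \<in> cball z0 (5 * R) \<Longrightarrow> norm (g w) \<le> M * (2/3) ^ length rs * norm (g z0)" by (rule gb2)
  have "norm (g z0) > 0" using fg[OF z0S] f0 by auto
  with gb2[of z0] R have "1 \<le> M * (2/3) ^ length rs" by simp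
  thus "(3/2) ^ length rs \<le> M" by (simp add: power_divide field_simps)
qed

text \<open>Zeros outside \<open>cball z0 (2 * R)\<close> may stay in the quotient: its
  zero-freeness is used on \<open>ball z0 (2 * R)\<close> only. The loss per removed zero is at most
  the factor \<open>2 * R / \<delta>\<close>, so the exponent \<open>n\<close> is kept explicit
  together with its bound in terms of \<open>M\<close>.\<close>

lemma holomorphic_lower_bound:
  fixes f :: "complex \<Rightarrow> complex"
  assumes S: "open S" "cball z0 (5 * R) \<subseteq> S" and holf: "f holomorphic_on S" and R: "R > 0"
    and M: "M > 1" and f0: "f z0 \<noteq> 0"
    and bd: "\<And>w. w \<in> cball z0 (5 * R) \<Longrightarrow> norm (f w) \<le> M * norm (f z0)"
    and z: "z \<in> cball z0 R" and \<delta>: "\<delta> \<ge> 0"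
    and far: "\<And>r. r \<in> cball z0 (2 * R) \<Longrightarrow> f r = 0 \<Longrightarrow> \<delta> \<le> dist z r"
  obtains n where "(3/2) ^ n \<le> M" "norm (f z0) * \<delta> ^ n \<le> M ^ 4 * (2 * R) ^ n * norm (f z)"
proof -
  \<comment> \<open>Dividing out a longest list of zeros counts multiplicities without the order of a zero;
    a longest list exists because \<open>(3/2) ^ n \<le> M\<close> for every admissible length \<open>n\<close>.\<close>
  define P where "P n \<longleftrightarrow> (\<exists>rs g. length rs = n \<and> g holomorphic_on S \<and> set rs \<subseteq> cball z0 (2 * R) \<and>
    (\<forall>w\<in>S. f w = g w * (\<Prod>r\<leftarrow>rs. w - r)))" for n :: nat
  have Pb: "(3/2) ^ n \<le> M" if "P n" for n
    using that divided_zeros_bound(3)[where f = f, OF S(2) _ R _ _ f0 bd] unfolding P_def by blast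
  obtain N :: nat where N: "M < (3/2) ^ N" using real_arch_pow[of "3/2" M] by auto
  have "n \<le> N" if "P n" for n
  proof (rule ccontr)
    assume "\<not> n \<le> N"
    hence "(3/2::real) ^ N \<le> (3/2) ^ n" by (intro power_increasing) auto
    with Pb[OF that] N show False by linarith
  qed
  moreover have "P 0" unfolding P_def using holf by auto
  ultimately have "P (Greatest P)" and Pmax: "\<And>n. P n \<Longrightarrow> n \<le> Greatest P"
    using GreatestI_nat[of P] Greatest_le_nat[of P] by blast+
  then obtain rs g where len: "length rs = Greatest P" and holg: "g holomorphic_on S"
    and rs: "set rs \<subseteq> cball z0 (2 * R)" and fg: "\<And>w. w \<in> S \<Longrightarrow> f w = g w * (\<Prod>r\<leftarrow>rs. w - r)"
    unfolding P_def by blast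
  note dz = divided_zeros_bound[OF S(2) holg R fg rs f0 bd]
  have sub: "cball z0 (2 * R) \<subseteq> S" using S(2) R subset_cball[of "2 * R" "5 * R" z0] by auto
  \<comment> \<open>A further zero of \<open>g\<close> could be divided out as well, the quotient
    being filled in at \<open>w\<close> by the derivative; this would give a list longer than the
    longest one.\<close>
  have gnz: "g w \<noteq> 0" if w: "w \<in> ball z0 (2 * R)" for w
  proof
    assume g0: "g w = 0"
    define q where "q = (\<lambda>x. if x = w then deriv g w else g x / (x - w))"
    have "q holomorphic_on S"
      by (rule pole_theorem_open_0[OF holg S(1), of w]) (use g0 in \<open>auto simp: q_def\<close>)
    moreover have "f x = q x * (\<Prod>r\<leftarrow>w # rs. x - r)" if "x \<in> S" for x
      using fg[OF that] g0 by (auto simp: q_def)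
    moreover have "set (w # rs) \<subseteq> cball z0 (2 * R)" using rs w by auto
    ultimately have "P (length (w # rs))"
      unfolding P_def by blast
    thus False using Pmax[of "length (w # rs)"] len by simp
  qed
  have gb: "norm (g w) \<le> M * norm (g z0)" if w: "w \<in> ball z0 (2 * R)" for w
  proof -
    have "norm (g w) \<le> M * (2/3) ^ length rs * norm (g z0)" using w R by (intro dz(2)) auto
    also have "\<dots> \<le> M * 1 * norm (g z0)"
      using M by (intro mult_right_mono mult_left_mono power_le_one) auto
    finally show ?thesis by simp
  qed
  have g_low: "norm (g z0) \<le> M ^ 4 * norm (g z)"
  proof (rule nonvanishing_lower_bound[where g = g, OF _ R M gnz gb z])
    show "g holomorphic_on ball z0 (2 * R)"
      using holg by (rule holomorphic_on_subset) (use sub in auto)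
  qed
  have zS: "z \<in> S" using z sub R subset_cball[of R "2 * R" z0] by auto
  have "\<delta> ^ length rs \<le> norm (\<Prod>r\<leftarrow>rs. z - r)"
  proof -
    have "\<delta> \<le> norm (z - r)" if r: "r \<in> set rs" for r
    proof -
      have "(\<Prod>x\<leftarrow>rs. r - x) = 0" using r by (simp add: prod_list_zero_iff)
      moreover have "r \<in> S" using r rs sub by auto
      ultimately have "f r = 0" using fg by simp
      thus ?thesis using far[of r] r rs by (auto simp: dist_norm)
    qed
    thus ?thesis using \<delta> by (induction rs) (auto simp: norm_mult intro!: mult_mono)
  qed
  hence "norm (g z) * \<delta> ^ length rs \<le> norm (f z)"
    using fg[OF zS] by (simp add: norm_mult mult_left_mono)
  have "norm (f z0) * \<delta> ^ length rs \<le> ((2 * R) ^ length rs * (M ^ 4 * norm (g z))) * \<delta> ^ length rs"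
    using dz(1) g_low R \<delta> by (intro mult_right_mono order_trans[OF dz(1)] mult_left_mono) auto
  also have "\<dots> \<le> M ^ 4 * (2 * R) ^ length rs * norm (f z)"
    using \<open>norm (g z) * \<delta> ^ length rs \<le> norm (f z)\<close> M R
      mult_left_mono[of "norm (g z) * \<delta> ^ length rs" "norm (f z)" "M ^ 4 * (2 * R) ^ length rs"]
    by (simp add: mult_ac)
  finally show ?thesis using that dz(3) by blast
qed

subsection \<open>Holomorphic functions of polynomial growth on vertical strips\<close>

text \<open>Strips are bounded on the right too, since \<open>x powr (-s)\<close> with
  \<open>x < 1\<close> grows exponentially in \<open>Re s\<close>. They stay strictly to the right
  of \<open>c\<close> because majorants may diverge at the boundary. The weight
  \<open>1 + norm s\<close> is at least 1, so exponents can be raised freely in sums and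
  products.\<close>

definition poly_growth :: "real \<Rightarrow> (complex \<Rightarrow> complex) \<Rightarrow> bool" where
  "poly_growth c g \<longleftrightarrow> g holomorphic_on {s. Re s > c} \<and>
     (\<forall>a b. c < a \<longrightarrow> (\<exists>A\<ge>0. \<exists>n. \<forall>s. a \<le> Re s \<and> Re s \<le> b \<longrightarrow> norm (g s) \<le> A * (1 + norm s) ^ n))"

lemma poly_growthI:
  assumes "g holomorphic_on {s. Re s > c}"
    and "\<And>a b. c < a \<Longrightarrow> \<exists>A\<ge>0. \<exists>n. \<forall>s. a \<le> Re s \<and> Re s \<le> b \<longrightarrow> norm (g s) \<le> A * (1 + norm s) ^ n"
  shows "poly_growth c g"
  using assms unfolding poly_growth_def by blast

lemma poly_growth_holomorphic: "poly_growth c g \<Longrightarrow> g holomorphic_on {s. Re s > c}"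
  by (simp add: poly_growth_def)

lemma poly_growthE:
  assumes "poly_growth c g" "c < a"
  obtains A n where "A \<ge> 0" "\<And>s. a \<le> Re s \<Longrightarrow> Re s \<le> b \<Longrightarrow> norm (g s) \<le> A * (1 + norm s) ^ n"
  using assms unfolding poly_growth_def by blast

lemma poly_growth_mono:
  assumes "poly_growth c g" "c \<le> c'"
  shows "poly_growth c' g"
proof (rule poly_growthI)
  show "g holomorphic_on {s. Re s > c'}"
    by (rule holomorphic_on_subset[OF poly_growth_holomorphic[OF assms(1)]]) (use assms(2) in auto)
qed (use assms in \<open>auto simp: poly_growth_def\<close>)

lemma poly_growth_cong:
  assumes "poly_growth c g" "\<And>s. Re s > c \<Longrightarrow> g s = h s"
  shows "poly_growth c h"
proof (rule poly_growthI)
  show "h holomorphic_on {s. Re s > c}"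
    using poly_growth_holomorphic[OF assms(1)] by (rule holomorphic_transform) (use assms(2) in auto)
  fix a b assume "c < a"
  with assms show "\<exists>A\<ge>0. \<exists>n. \<forall>s. a \<le> Re s \<and> Re s \<le> b \<longrightarrow> norm (h s) \<le> A * (1 + norm s) ^ n"
    unfolding poly_growth_def by (metis less_le_trans)
qed

lemma poly_growth_const [intro]: "poly_growth c (\<lambda>_. x)"
proof (rule poly_growthI)
  fix a b :: real
  show "\<exists>A\<ge>0. \<exists>n. \<forall>s. a \<le> Re s \<and> Re s \<le> b \<longrightarrow> norm x \<le> A * (1 + norm s) ^ n"
    by (rule exI[of _ "norm x"]) (auto intro!: exI[of _ 0])
qed auto

lemma poly_growth_ident [intro]: "poly_growth c (\<lambda>s. s)"
proof (rule poly_growthI)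
  fix a b :: real
  show "\<exists>A\<ge>0. \<exists>n. \<forall>s. a \<le> Re s \<and> Re s \<le> b \<longrightarrow> norm s \<le> A * (1 + norm s) ^ n"
    by (rule exI[of _ 1]) (auto intro!: exI[of _ 1])
qed auto

lemma poly_growth_mult [intro]:
  assumes "poly_growth c g" "poly_growth c h"
  shows "poly_growth c (\<lambda>s. g s * h s)"
proof (rule poly_growthI)
  show "(\<lambda>s. g s * h s) holomorphic_on {s. Re s > c}"
    using assms by (intro holomorphic_intros poly_growth_holomorphic)
  fix a b :: real assume a: "c < a"
  obtain A n where A: "A \<ge> 0" "\<And>s. a \<le> Re s \<Longrightarrow> Re s \<le> b \<Longrightarrow> norm (g s) \<le> A * (1 + norm s) ^ n"
    using poly_growthE[OF assms(1) a, where b = b] by blast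
  obtain B m where B: "B \<ge> 0" "\<And>s. a \<le> Re s \<Longrightarrow> Re s \<le> b \<Longrightarrow> norm (h s) \<le> B * (1 + norm s) ^ m"
    using poly_growthE[OF assms(2) a, where b = b] by blast
  show "\<exists>A\<ge>0. \<exists>n. \<forall>s. a \<le> Re s \<and> Re s \<le> b \<longrightarrow> norm (g s * h s) \<le> A * (1 + norm s) ^ n"
  proof (intro exI conjI allI impI)
    show "A * B \<ge> 0" using A B by simp
    fix s assume s: "a \<le> Re s \<and> Re s \<le> b"
    have "norm (g s * h s) \<le> (A * (1 + norm s) ^ n) * (B * (1 + norm s) ^ m)"
      unfolding norm_mult using s A B by (intro mult_mono) auto
    thus "norm (g s * h s) \<le> A * B * (1 + norm s) ^ (n + m)" by (simp add: power_add mult_ac)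
  qed
qed

lemma poly_growth_add [intro]:
  assumes "poly_growth c g" "poly_growth c h"
  shows "poly_growth c (\<lambda>s. g s + h s)"
proof (rule poly_growthI)
  show "(\<lambda>s. g s + h s) holomorphic_on {s. Re s > c}"
    using assms by (intro holomorphic_intros poly_growth_holomorphic)
  fix a b :: real assume a: "c < a"
  obtain A n where A: "A \<ge> 0" "\<And>s. a \<le> Re s \<Longrightarrow> Re s \<le> b \<Longrightarrow> norm (g s) \<le> A * (1 + norm s) ^ n"
    using poly_growthE[OF assms(1) a, where b = b] by blast
  obtain B m where B: "B \<ge> 0" "\<And>s. a \<le> Re s \<Longrightarrow> Re s \<le> b \<Longrightarrow> norm (h s) \<le> B * (1 + norm s) ^ m"
    using poly_growthE[OF assms(2) a, where b = b] by blast
  show "\<exists>A\<ge>0. \<exists>n. \<forall>s. a \<le> Re s \<and> Re s \<le> b \<longrightarrow> norm (g s + h s) \<le> A * (1 + norm s) ^ n"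
  proof (intro exI conjI allI impI)
    show "A + B \<ge> 0" using A B by simp
    fix s assume s: "a \<le> Re s \<and> Re s \<le> b"
    have "norm (g s + h s) \<le> norm (g s) + norm (h s)" by (rule norm_triangle_ineq)
    also have "\<dots> \<le> A * (1 + norm s) ^ n + B * (1 + norm s) ^ m" using s A B by (intro add_mono) auto
    also have "\<dots> \<le> A * (1 + norm s) ^ (n + m) + B * (1 + norm s) ^ (n + m)"
      using A B by (intro add_mono mult_left_mono power_increasing) auto
    finally show "norm (g s + h s) \<le> (A + B) * (1 + norm s) ^ (n + m)" by (simp add: algebra_simps)
  qed
qed

lemma poly_growth_sum [intro]:
  "(\<And>i. i \<in> I \<Longrightarrow> poly_growth c (g i)) \<Longrightarrow> poly_growth c (\<lambda>s. \<Sum>i\<in>I. g i s)"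
  by (induction I rule: infinite_finite_induct) auto

lemma poly_growth_shift:
  assumes "poly_growth c g"
  shows "poly_growth (c - d) (\<lambda>s. g (s + of_real d))"
proof (rule poly_growthI)
  have "(g \<circ> (\<lambda>s. s + of_real d)) holomorphic_on {s. Re s > c - d}"
    by (rule holomorphic_on_compose_gen[OF _ poly_growth_holomorphic[OF assms]])
       (auto intro!: holomorphic_intros)
  thus "(\<lambda>s. g (s + of_real d)) holomorphic_on {s. Re s > c - d}" by (simp add: o_def)
  fix a b :: real assume a: "c - d < a"
  obtain A n where A: "A \<ge> 0" "\<And>s. a + d \<le> Re s \<Longrightarrow> Re s \<le> b + d \<Longrightarrow> norm (g s) \<le> A * (1 + norm s) ^ n"
    using poly_growthE[OF assms, of "a + d" "b + d"] a by auto
  show "\<exists>A\<ge>0. \<exists>n. \<forall>s. a \<le> Re s \<and> Re s \<le> b \<longrightarrow> norm (g (s + of_real d)) \<le> A * (1 + norm s) ^ n"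
  proof (intro exI conjI allI impI)
    show "A * (1 + \<bar>d\<bar>) ^ n \<ge> 0" using A by simp
    fix s :: complex assume s: "a \<le> Re s \<and> Re s \<le> b"
    have "norm (g (s + of_real d)) \<le> A * (1 + norm (s + of_real d)) ^ n" using A(2) s by simp
    also have "\<dots> \<le> A * ((1 + \<bar>d\<bar>) * (1 + norm s)) ^ n"
    proof (intro mult_left_mono power_mono)
      have "norm (s + of_real d) \<le> norm s + \<bar>d\<bar>" using norm_triangle_ineq[of s "of_real d"] by simp
      moreover have "0 \<le> \<bar>d\<bar> * norm s" by simp
      ultimately show "1 + norm (s + of_real d) \<le> (1 + \<bar>d\<bar>) * (1 + norm s)"
        unfolding distrib_left distrib_right by linarith
    qed (use A in auto)
    finally show "norm (g (s + of_real d)) \<le> A * (1 + \<bar>d\<bar>) ^ n * (1 + norm s) ^ n"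
      by (simp add: power_mult_distrib mult_ac)
  qed
qed

lemma poly_growth_pochhammer [intro]: "poly_growth c (\<lambda>s. pochhammer s j)"
  by (induction j) (auto simp: pochhammer_Suc intro!: poly_growth_mult poly_growth_add)

section \<open>Real powers and series of functions of polynomial growth\<close>

text \<open>The power is monotone in the exponent, with a direction that depends on whether
  \<open>x \<ge> 1\<close>. The sum of both endpoint values serves either case, as needed for the
  bases \<open>real m + \<alpha>\<close>, of which the first may lie below 1.\<close>

lemma powr_le_endpoints:
  fixes x :: real
  assumes "x > 0" "a \<le> t" "t \<le> b"
  shows "x powr (-t) \<le> x powr (-a) + x powr (-b)"
proof (cases "x \<ge> 1")
  case True
  hence "x powr (-t) \<le> x powr (-a)" using assms by (intro powr_mono) auto
  thus ?thesis by (simp add: add_increasing2)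
next
  case False
  hence "x powr (-t) \<le> x powr (-b)" using assms by (intro powr_mono') auto
  thus ?thesis by (simp add: add_increasing)
qed

lemma norm_of_real_powr: "x > 0 \<Longrightarrow> norm (complex_of_real x powr s) = x powr Re s"
  by (simp add: norm_powr_real_powr)

lemma poly_growth_powr [intro]:
  assumes "x > 0"
  shows "poly_growth c (\<lambda>s. complex_of_real x powr (-s))"
proof (rule poly_growthI)
  show "(\<lambda>s. complex_of_real x powr (-s)) holomorphic_on {s. Re s > c}"
    by (intro holomorphic_intros)
  fix a b :: real
  show "\<exists>A\<ge>0. \<exists>n. \<forall>s. a \<le> Re s \<and> Re s \<le> b \<longrightarrow> norm (complex_of_real x powr (-s)) \<le> A * (1 + norm s) ^ n"
    by (rule exI[of _ "x powr (-a) + x powr (-b)"])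
       (use assms in \<open>auto intro!: exI[of _ 0] powr_le_endpoints simp: norm_of_real_powr\<close>)
qed

text \<open>The majorant separates the dependence on \<open>s\<close> from that on \<open>m\<close>.
  Summing over \<open>m\<close> gives the growth bound, and on a small disc, where
  \<open>norm s\<close> is bounded, the same majorant feeds the Weierstrass test and hence yields
  holomorphy.\<close>

lemma poly_growth_suminf:
  fixes f :: "nat \<Rightarrow> complex \<Rightarrow> complex"
  assumes hol: "\<And>m. f m holomorphic_on {s. Re s > c}"
    and bd: "\<And>a b. c < a \<Longrightarrow> \<exists>A\<ge>0. \<exists>n M. summable M \<and> (\<forall>m. 0 \<le> M m) \<and>
       (\<forall>m s. a \<le> Re s \<and> Re s \<le> b \<longrightarrow> norm (f m s) \<le> A * (1 + norm s) ^ n * M m)"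
  shows "poly_growth c (\<lambda>s. \<Sum>m. f m s)" and "Re s > c \<Longrightarrow> summable (\<lambda>m. norm (f m s))"
proof -
  have sm: "summable (\<lambda>m. norm (f m s))" if s: "Re s > c" for s
  proof -
    obtain A n M where M: "summable M" "\<And>m. norm (f m s) \<le> A * (1 + norm s) ^ n * M m"
      using bd[OF s, of "Re s"] by blast
    show ?thesis
      by (rule summable_comparison_test'[OF summable_mult[OF M(1)]]) (use M(2) in auto)
  qed
  thus "Re s > c \<Longrightarrow> summable (\<lambda>m. norm (f m s))" .
  show "poly_growth c (\<lambda>s. \<Sum>m. f m s)"
  proof (rule poly_growthI)
    fix a b :: real assume a: "c < a"
    then obtain A n M where A: "A \<ge> 0" and M: "summable M" "\<And>m s. a \<le> Re s \<and> Re s \<le> b \<Longrightarrow> norm (f m s) \<le> A * (1 + norm s) ^ n * M m" "\<And>m. 0 \<le> M m"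
      using bd[OF a, of b] by metis
    show "\<exists>A\<ge>0. \<exists>n. \<forall>s. a \<le> Re s \<and> Re s \<le> b \<longrightarrow> norm (\<Sum>m. f m s) \<le> A * (1 + norm s) ^ n"
    proof (intro exI conjI allI impI)
      show "0 \<le> A * suminf M" using A M by (simp add: suminf_nonneg)
      fix s assume s: "a \<le> Re s \<and> Re s \<le> b"
      have "norm (\<Sum>m. f m s) \<le> (\<Sum>m. norm (f m s))"
        by (rule summable_norm) (use sm[of s] s a in auto)
      also have "\<dots> \<le> (\<Sum>m. A * (1 + norm s) ^ n * M m)"
        by (rule suminf_le) (use sm[of s] s a M in \<open>auto intro: summable_mult\<close>)
      also have "\<dots> = A * (1 + norm s) ^ n * suminf M" by (rule suminf_mult[OF M(1)])
      finally show "norm (\<Sum>m. f m s) \<le> A * suminf M * (1 + norm s) ^ n" by (simp add: mult_ac)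
    qed
  next
    show "(\<lambda>s. \<Sum>m. f m s) holomorphic_on {s. Re s > c}"
    proof (rule holomorphic_uniform_sequence)
      show "open {s. Re s > c}" by (rule open_halfspace_Re_gt)
      show "(\<lambda>s. \<Sum>m<n. f m s) holomorphic_on {s. Re s > c}" for n
        by (intro holomorphic_intros hol)
      fix x assume x: "x \<in> {s. Re s > c}"
      define d where "d = (Re x - c) / 2"
      have d: "d > 0" "c < Re x - d" using x by (auto simp: d_def field_simps)
      have strip: "Re x - d \<le> Re s \<and> Re s \<le> Re x + d" if "s \<in> cball x d" for s
        using that abs_Re_le_cmod[of "x - s"] by (auto simp: dist_norm)
      obtain A n M where A: "A \<ge> 0" and M: "summable M" "\<And>m s. Re x - d \<le> Re s \<and> Re s \<le> Re x + d \<Longrightarrow> norm (f m s) \<le> A * (1 + norm s) ^ n * M m" "\<And>m. 0 \<le> M m"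
        using bd[OF d(2), of "Re x + d"] by metis
      have "uniform_limit (cball x d) (\<lambda>n s. \<Sum>m<n. f m s) (\<lambda>s. \<Sum>m. f m s) sequentially"
      proof (rule Weierstrass_m_test)
        show "summable (\<lambda>m. A * (1 + (norm x + d)) ^ n * M m)"
          by (intro summable_mult M)
        fix m s assume s: "s \<in> cball x d"
        have "norm s \<le> norm x + d" using s norm_triangle_ineq2[of s x] by (simp add: dist_norm norm_minus_commute)
        have "norm (f m s) \<le> A * (1 + norm s) ^ n * M m" using M(2) strip[OF s] by blast
        also have "\<dots> \<le> A * (1 + (norm x + d)) ^ n * M m"
          using A M(3) \<open>norm s \<le> norm x + d\<close> by (intro mult_right_mono mult_left_mono power_mono) auto
        finally show "norm (f m s) \<le> A * (1 + (norm x + d)) ^ n * M m" .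
      qed
      moreover have "cball x d \<subseteq> {s. Re s > c}" using strip d by force
      ultimately show "\<exists>d>0. cball x d \<subseteq> {s. Re s > c} \<and> uniform_limit (cball x d) (\<lambda>n s. \<Sum>m<n. f m s) (\<lambda>s. \<Sum>m. f m s) sequentially"
        using d by blast
    qed
  qed
qed

section \<open>The Lerch series, its Taylor remainder and the recurrence\<close>

lemma summable_shifted_powr:
  fixes \<alpha> p :: real
  assumes "\<alpha> > 0" "p > 1"
  shows "summable (\<lambda>m. (real m + \<alpha>) powr (-p))"
proof (rule summable_comparison_test')
  show "summable (\<lambda>m. real m powr (-p))" using assms by (simp add: summable_real_powr_iff)
  fix m :: nat assume "m \<ge> 1"
  thus "norm ((real m + \<alpha>) powr (-p)) \<le> real m powr (-p)" using assms by (auto intro!: powr_mono2')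
qed

text \<open>The exponential is replaced by a general \<omega>: only the fact that a shift of
  \<open>m\<close> by one multiplies the coefficient by \<omega> matters for the recurrence.\<close>

definition lerch_series :: "complex \<Rightarrow> real \<Rightarrow> complex \<Rightarrow> complex" where
  "lerch_series \<omega> \<alpha> s = (\<Sum>m. \<omega> ^ m * of_real (real m + \<alpha>) powr (-s))"

lemma lerch_series:
  assumes "\<alpha> > 0" "norm \<omega> \<le> 1"
  shows poly_growth_lerch_series: "poly_growth 1 (lerch_series \<omega> \<alpha>)"
    and summable_lerch_series: "Re s > 1 \<Longrightarrow> summable (\<lambda>m. norm (\<omega> ^ m * of_real (real m + \<alpha>) powr (-s)))"
proof -
  have 1: "(\<lambda>s. \<omega> ^ m * of_real (real m + \<alpha>) powr (-s)) holomorphic_on {s. Re s > 1}" for m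
    by (intro holomorphic_intros)
  have 2: "\<exists>A\<ge>0. \<exists>n M. summable M \<and> (\<forall>m. 0 \<le> M m) \<and> (\<forall>m s. a \<le> Re s \<and> Re s \<le> b \<longrightarrow>
     norm (\<omega> ^ m * of_real (real m + \<alpha>) powr (-s)) \<le> A * (1 + norm s) ^ n * M m)" if a: "1 < a" for a b
  proof (cases "a \<le> b")
    case True
    \<comment> \<open>The second summand is summable only if \<open>b > 1\<close>, which follows
      from \<open>1 < a \<le> b\<close>; the empty strip \<open>b < a\<close> is treated
      apart.\<close>
    define M where "M m = (real m + \<alpha>) powr (-a) + (real m + \<alpha>) powr (-b)" for m :: nat
    have "summable M" unfolding M_def
      using a True assms by (intro summable_add summable_shifted_powr) auto
    moreover have "norm (\<omega> ^ m * of_real (real m + \<alpha>) powr (-s)) \<le> 1 * (1 + norm s) ^ 0 * M m"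
      if "a \<le> Re s \<and> Re s \<le> b" for m s
    proof -
      have "norm (\<omega> ^ m * of_real (real m + \<alpha>) powr (-s)) = norm \<omega> ^ m * (real m + \<alpha>) powr (- Re s)"
        using assms(1) by (simp only: norm_mult norm_power norm_of_real_powr add_nonneg_pos of_nat_0_le_iff uminus_complex.sel)
      also have "\<dots> \<le> 1 * ((real m + \<alpha>) powr (-a) + (real m + \<alpha>) powr (-b))"
        using assms that by (intro mult_mono power_le_one powr_le_endpoints) auto
      finally show ?thesis by (simp add: M_def)
    qed
    moreover have "0 \<le> M m" for m by (simp add: M_def)
    ultimately show ?thesis using zero_le_one by blast
  next
    case False thus ?thesis by (intro exI[of _ 0] conjI exI[of _ 0] exI[of _ "\<lambda>_. 0"]) auto
  qed
  show "poly_growth 1 (lerch_series \<omega> \<alpha>)"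
    using poly_growth_suminf(1)[OF 1 2] unfolding lerch_series_def[abs_def] by blast
  show "Re s > 1 \<Longrightarrow> summable (\<lambda>m. norm (\<omega> ^ m * of_real (real m + \<alpha>) powr (-s)))"
    using poly_growth_suminf(2)[OF 1 2] by blast
qed

definition powr_taylor_rem :: "nat \<Rightarrow> real \<Rightarrow> complex \<Rightarrow> complex" where
  "powr_taylor_rem k x s = of_real (x + 1) powr (-s) -
     (\<Sum>j\<le>k. (-1) ^ j * pochhammer s j / fact j * of_real x powr (-(s + of_nat j)))"

text \<open>On the segment from \<open>x\<close> to \<open>x + 1\<close> the derivative of order
  \<open>k + 1\<close> is largest at the left end, as its exponent is not positive. The extra decay
  of order \<open>k + 1\<close> in \<open>x\<close> is what makes the remainder series converge
  further to the left.\<close>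

lemma norm_powr_taylor_rem_le:
  assumes x: "x > 0" and s: "Re s + real k + 1 \<ge> 0"
  shows "norm (powr_taylor_rem k x s) \<le> norm (pochhammer s (Suc k)) * x powr (-(Re s + real k + 1))"
proof -
  \<comment> \<open>\<open>f i\<close> is the derivative of order \<open>i\<close> of
    \<open>z powr (-s)\<close> in \<open>z\<close>; sign and Pochhammer symbol collect the factors
    \<open>-(s + j)\<close> for \<open>j < i\<close>.\<close>
  define f where "f i z = (-1) ^ i * pochhammer s i * z powr (-(s + of_nat i))" for i and z :: complex
  define S where "S = closed_segment (of_real x) (complex_of_real (x + 1))"
  have S: "\<exists>y\<ge>x. z = of_real y" if "z \<in> S" for z
  proof -
    have "Im z = 0" "x \<le> Re z"
      using that by (auto simp: S_def closed_segment_same_Im closed_segment_eq_real_ivl)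
    thus ?thesis by (intro exI[of _ "Re z"]) (auto simp: complex_eq_iff)
  qed
  define B where "B = norm (pochhammer s (Suc k)) * x powr (-(Re s + real k + 1))"
  have "norm (f 0 (of_real (x + 1)) - (\<Sum>i\<le>k. f i (of_real x) * (of_real (x + 1) - of_real x) ^ i / fact i))
      \<le> B * norm (complex_of_real (x + 1) - of_real x) ^ Suc k / fact k"
  proof (rule complex_Taylor)
    show "convex S" "of_real x \<in> S" "of_real (x + 1) \<in> S" by (auto simp: S_def)
    fix i z assume "z \<in> S"
    then obtain y where y: "z = of_real y" "y \<ge> x" using S by blast
    hence z: "z \<notin> \<real>\<^sub>\<le>\<^sub>0" using x by (simp add: complex_nonpos_Reals_iff)
    have "(f i has_field_derivative (-1) ^ i * pochhammer s i *
        (-(s + of_nat i) * z powr (-(s + of_nat i) - 1))) (at z within S)"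
      unfolding f_def[abs_def]
      by (intro DERIV_cmult has_field_derivative_at_within[OF has_field_derivative_powr] z)
    also have "-(s + of_nat i) - 1 = -(s + of_nat (Suc i))" by simp
    also have "(-1) ^ i * pochhammer s i * (-(s + of_nat i) * z powr (-(s + of_nat (Suc i)))) = f (Suc i) z"
      unfolding f_def pochhammer_Suc power_Suc by algebra
    finally show "(f i has_field_derivative f (Suc i) z) (at z within S)" .
  next
    fix z assume "z \<in> S"
    then obtain y where y: "z = of_real y" "y \<ge> x" using S by blast
    have "norm (f (Suc k) z) = norm (pochhammer s (Suc k)) * y powr (-(Re s + real k + 1))"
      using y x by (simp add: f_def norm_mult norm_power norm_of_real_powr algebra_simps)
    also have "\<dots> \<le> B" unfolding B_def using y x s
      by (intro mult_left_mono powr_mono2') auto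
    finally show "norm (f (Suc k) z) \<le> B" .
  qed
  also have "\<dots> = B / fact k" by simp
  also have "\<dots> \<le> B / 1" unfolding B_def by (intro divide_left_mono) (auto simp: fact_ge_1)
  finally show ?thesis by (simp add: f_def powr_taylor_rem_def B_def mult_ac)
qed

definition lerch_rem :: "complex \<Rightarrow> real \<Rightarrow> nat \<Rightarrow> complex \<Rightarrow> complex" where
  "lerch_rem \<omega> \<alpha> k s = (\<Sum>m. \<omega> ^ m * powr_taylor_rem k (real m + \<alpha>) s)"

text \<open>For \<open>Re s > -k\<close> the exponent \<open>Re s + k + 1\<close> in the remainder
  estimate exceeds 1, so the series over \<open>m\<close> converges; the Pochhammer symbol
  contributes the polynomial growth.\<close>

lemma poly_growth_lerch_rem:
  assumes \<alpha>: "\<alpha> > 0" and \<omega>: "norm \<omega> \<le> 1"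
  shows "poly_growth (- real k) (lerch_rem \<omega> \<alpha> k)"
  unfolding lerch_rem_def[abs_def]
proof (rule poly_growth_suminf(1))
  show "(\<lambda>s. \<omega> ^ m * powr_taylor_rem k (real m + \<alpha>) s) holomorphic_on {s. Re s > - real k}" for m
    unfolding powr_taylor_rem_def
    by (intro holomorphic_intros poly_growth_holomorphic[OF poly_growth_pochhammer]) auto
  fix a b assume a: "- real k < a"
  show "\<exists>A\<ge>0. \<exists>n M. summable M \<and> (\<forall>m. 0 \<le> M m) \<and> (\<forall>m s. a \<le> Re s \<and> Re s \<le> b \<longrightarrow>
     norm (\<omega> ^ m * powr_taylor_rem k (real m + \<alpha>) s) \<le> A * (1 + norm s) ^ n * M m)"
  proof (cases "a \<le> b")
    case True
    obtain A n where A: "A \<ge> 0" "\<And>s. a \<le> Re s \<Longrightarrow> Re s \<le> b \<Longrightarrow> norm (pochhammer s (Suc k)) \<le> A * (1 + norm s) ^ n"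
      using poly_growthE[OF poly_growth_pochhammer a, where b = b] by blast
    define M where "M m = (real m + \<alpha>) powr (-(a + real k + 1)) + (real m + \<alpha>) powr (-(b + real k + 1))" for m :: nat
    have "summable M"
      unfolding M_def using a True assms by (intro summable_add summable_shifted_powr) auto
    moreover have "norm (\<omega> ^ m * powr_taylor_rem k (real m + \<alpha>) s) \<le> A * (1 + norm s) ^ n * M m"
      if s: "a \<le> Re s \<and> Re s \<le> b" for m s
    proof -
      have "norm (\<omega> ^ m * powr_taylor_rem k (real m + \<alpha>) s) \<le>
          1 * (norm (pochhammer s (Suc k)) * (real m + \<alpha>) powr (-(Re s + real k + 1)))"
        unfolding norm_mult norm_power using assms a s
        by (intro mult_mono norm_powr_taylor_rem_le power_le_one) auto
      also have "\<dots> \<le> 1 * ((A * (1 + norm s) ^ n) * M m)"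
        unfolding M_def using assms s A
        by (intro mult_mono powr_le_endpoints) auto
      finally show ?thesis by simp
    qed
    moreover have "0 \<le> M m" for m by (simp add: M_def)
    ultimately show ?thesis using A(1) by blast
  next
    case False thus ?thesis by (intro exI[of _ 0] conjI exI[of _ 0] exI[of _ "\<lambda>_. 0"]) auto
  qed
qed

text \<open>Multiply the Taylor expansion of \<open>(m + 1 + \<alpha>) powr (-s)\<close> about
  \<open>m + \<alpha>\<close> by \<open>\<omega> ^ Suc m\<close> and sum. The left side is the
  series without its first term, and the Taylor term \<open>j = 0\<close> is \<omega> times the
  series itself, whence the coefficient \<open>1 - \<omega>\<close>.\<close>

lemma lerch_series_recurrence:
  assumes \<alpha>: "\<alpha> > 0" and \<omega>: "norm \<omega> \<le> 1" and s: "Re s > 1"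
  shows "(1 - \<omega>) * lerch_series \<omega> \<alpha> s = of_real \<alpha> powr (-s) + \<omega> * lerch_rem \<omega> \<alpha> k s +
     \<omega> * (\<Sum>j=1..k. (-1) ^ j * pochhammer s j / fact j * lerch_series \<omega> \<alpha> (s + of_nat j))"
proof -
  define c where "c j = (-1) ^ j * pochhammer s j / fact j" for j
  have sums: "(\<lambda>m. \<omega> ^ m * of_real (real m + \<alpha>) powr (-(s + of_nat j))) sums lerch_series \<omega> \<alpha> (s + of_nat j)" for j
    unfolding lerch_series_def
    by (intro summable_sums summable_norm_cancel[OF summable_lerch_series[OF \<alpha> \<omega>]]) (use s in auto)
  have 0: "(\<lambda>m. \<omega> ^ m * of_real (real m + \<alpha>) powr (-s)) sums lerch_series \<omega> \<alpha> s"
    using sums[of 0] by simp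
  have 1: "(\<lambda>m. \<omega> ^ Suc m * of_real (real (Suc m) + \<alpha>) powr (-s)) sums (lerch_series \<omega> \<alpha> s - of_real \<alpha> powr (-s))"
    using 0 by (subst sums_Suc_iff) simp
  have 2: "(\<lambda>m. \<Sum>j\<le>k. c j * (\<omega> ^ m * of_real (real m + \<alpha>) powr (-(s + of_nat j)))) sums
     (\<Sum>j\<le>k. c j * lerch_series \<omega> \<alpha> (s + of_nat j))"
    by (intro sums_sum sums_mult sums)
  have "(\<lambda>m. \<omega> ^ Suc m * of_real (real (Suc m) + \<alpha>) powr (-s) -
       \<omega> * (\<Sum>j\<le>k. c j * (\<omega> ^ m * of_real (real m + \<alpha>) powr (-(s + of_nat j))))) sums
     (lerch_series \<omega> \<alpha> s - of_real \<alpha> powr (-s) - \<omega> * (\<Sum>j\<le>k. c j * lerch_series \<omega> \<alpha> (s + of_nat j)))"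
    by (intro sums_diff sums_mult 1 2)
  also have "(\<lambda>m. \<omega> ^ Suc m * of_real (real (Suc m) + \<alpha>) powr (-s) -
       \<omega> * (\<Sum>j\<le>k. c j * (\<omega> ^ m * of_real (real m + \<alpha>) powr (-(s + of_nat j))))) =
     (\<lambda>m. \<omega> * (\<omega> ^ m * powr_taylor_rem k (real m + \<alpha>) s))"
    by (simp add: powr_taylor_rem_def c_def sum_distrib_left algebra_simps)
  finally have 3: "(\<lambda>m. \<omega> * (\<omega> ^ m * powr_taylor_rem k (real m + \<alpha>) s)) sums
    (lerch_series \<omega> \<alpha> s - of_real \<alpha> powr (-s) - \<omega> * (\<Sum>j\<le>k. c j * lerch_series \<omega> \<alpha> (s + of_nat j)))" .
  have "\<omega> * lerch_rem \<omega> \<alpha> k s =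
    lerch_series \<omega> \<alpha> s - of_real \<alpha> powr (-s) - \<omega> * (\<Sum>j\<le>k. c j * lerch_series \<omega> \<alpha> (s + of_nat j))"
  proof (cases "\<omega> = 0")
    case True thus ?thesis using sums_unique[OF 3] by simp
  next
    case False
    hence "summable (\<lambda>m. \<omega> ^ m * powr_taylor_rem k (real m + \<alpha>) s)"
      using sums_summable[OF 3] by (simp add: summable_cmult_iff)
    thus ?thesis using sums_unique[OF 3] by (simp add: lerch_rem_def suminf_mult)
  qed
  moreover have "(\<Sum>j\<le>k. c j * lerch_series \<omega> \<alpha> (s + of_nat j)) =
     lerch_series \<omega> \<alpha> s + (\<Sum>j=1..k. c j * lerch_series \<omega> \<alpha> (s + of_nat j))"
    by (simp add: atMost_atLeast0 sum.atLeast_Suc_atMost c_def)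
  ultimately show ?thesis by (simp add: c_def algebra_simps)
qed

subsection \<open>Continuation of the Lerch series\<close>

text \<open>
  Agreement is only demanded for \<open>Re s > 2\<close>, since for \<open>\<omega> = 1\<close> the recurrence, valid for
  \<open>Re s > 1\<close>, determines the continuation at \<open>s + 1\<close>.
\<close>

lemma poly_growth_glue:
  assumes ex: "\<And>n::nat. \<exists>g. poly_growth (- real n) g \<and> (\<forall>s. Re s > 2 \<longrightarrow> g s = f s)"
    and holf: "f holomorphic_on {s. Re s > 1}"
  obtains g where "\<And>c. poly_growth c g" "\<And>s. Re s > 1 \<Longrightarrow> g s = f s"
proof -
  have uniq: "h1 s = h2 s"
    if "h1 holomorphic_on {s. Re s > a}" "h2 holomorphic_on {s. Re s > a}"
       "\<And>s. Re s > 2 \<Longrightarrow> h1 s = h2 s" "Re s > a" for h1 h2 a s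
  proof (rule analytic_continuation_open[of "{s. Re s > max a 2}" "{s. Re s > a}" h1 h2])
    have "complex_of_real (max a 2 + 1) \<in> {s. Re s > max a 2}" by (simp add: max_def)
    thus "{s. Re s > max a 2} \<noteq> {}" by blast
    show "open {s. Re s > max a 2}" "open {s. Re s > a}" by (rule open_halfspace_Re_gt)+
    show "connected {s. Re s > a}" by (intro convex_connected convex_halfspace_Re_gt)
  qed (use that in auto)
  obtain G where G: "\<And>n. poly_growth (- real n) (G n)" "\<And>n s. Re s > 2 \<Longrightarrow> G n s = f s"
    using ex by metis
  \<comment> \<open>The index is a natural number exceeding \<open>- Re s\<close>, so
    \<open>s\<close> lies in the domain of the chosen continuation; by uniqueness any other such
    index gives the same value.\<close>
  define g where "g s = G (nat \<lceil>- Re s\<rceil> + 1) s" for s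
  have gG: "g s = G n s" if s: "Re s > - real n" for n s
  proof -
    define m where "m = nat \<lceil>- Re s\<rceil> + 1"
    have m: "- real m < Re s" unfolding m_def by linarith
    have "G m s = G n s"
    proof (rule uniq[of "G m" "- real (min m n)" "G n"])
      show "- real (min m n) < Re s" using m s by auto
      show "G m holomorphic_on {s. Re s > - real (min m n)}" "G n holomorphic_on {s. Re s > - real (min m n)}"
        by (intro poly_growth_holomorphic poly_growth_mono[OF G(1)], simp)+
    qed (simp add: G(2))
    thus ?thesis by (simp add: g_def m_def)
  qed
  show ?thesis
  proof (rule that)
    fix c
    obtain n where n: "- c \<le> real n" using real_arch_simple by blast
    have "poly_growth (- real n) g" by (rule poly_growth_cong[OF G(1)]) (simp add: gG)
    thus "poly_growth c g" by (rule poly_growth_mono) (use n in simp)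
  next
    fix s :: complex assume s: "Re s > 1"
    have "G 0 holomorphic_on {s. Re s > 1}"
      by (intro poly_growth_holomorphic poly_growth_mono[OF G(1)]) simp
    hence "G 0 s = f s" by (rule uniq[of "G 0" 1 f, OF _ holf]) (use G(2) s in auto)
    thus "g s = f s" using gG[of 0 s] s by simp
  qed
qed

text \<open>For \<omega> different from 1 the recurrence is divided by \<open>1 - \<omega>\<close>.
  Its right side involves the series only at \<open>s + j\<close> with \<open>j \<ge> 1\<close>, so
  each use extends the domain by one unit. For \<omega> = 1 the left side vanishes and the term
  \<open>j = 1\<close> equals \<open>- s * lerch_series \<omega> \<alpha> (s + 1)\<close>, so the
  recurrence yields the product \<open>(s - 1) * lerch_series \<omega> \<alpha> s\<close> with
  \<open>s\<close> shifted by one.\<close>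

lemma lerch_series_continuation:
  assumes \<alpha>: "\<alpha> > 0" and \<omega>: "norm \<omega> \<le> 1"
  obtains H where "\<And>c. poly_growth c H" "\<And>s. Re s > 1 \<Longrightarrow> H s = (s - 1) * lerch_series \<omega> \<alpha> s"
proof (cases "\<omega> = 1")
  case False
  have "\<exists>g. poly_growth (- real n) g \<and> (\<forall>s. Re s > 2 \<longrightarrow> g s = lerch_series \<omega> \<alpha> s)" for n
  proof -
    have "\<exists>g. poly_growth (1 - real n) g \<and> (\<forall>s. Re s > 2 \<longrightarrow> g s = lerch_series \<omega> \<alpha> s)" for n
    proof (induction n)
      case 0
      show ?case using poly_growth_lerch_series[OF \<alpha> \<omega>] by auto
    next
      case (Suc n)
      then obtain g where g: "poly_growth (1 - real n) g" "\<And>s. Re s > 2 \<Longrightarrow> g s = lerch_series \<omega> \<alpha> s"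
        by blast
      define h where "h s = inverse (1 - \<omega>) * (of_real \<alpha> powr (-s) + \<omega> * lerch_rem \<omega> \<alpha> n s +
        \<omega> * (\<Sum>j=1..n. ((-1) ^ j / fact j) * pochhammer s j * g (s + of_real (real j))))" for s
      have "poly_growth (1 - real (Suc n)) h"
        unfolding h_def
      proof (intro poly_growth_mult poly_growth_add poly_growth_const poly_growth_powr poly_growth_sum poly_growth_pochhammer \<alpha>)
        show "poly_growth (1 - real (Suc n)) (lerch_rem \<omega> \<alpha> n)"
          by (rule poly_growth_mono[OF poly_growth_lerch_rem[OF \<alpha> \<omega>]]) simp
        fix j assume "j \<in> {1..n}"
        thus "poly_growth (1 - real (Suc n)) (\<lambda>s. g (s + of_real (real j)))"
          by (intro poly_growth_mono[OF poly_growth_shift[OF g(1)]]) auto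
      qed
      moreover have "h s = lerch_series \<omega> \<alpha> s" if s: "Re s > 2" for s
      proof -
        have "(1 - \<omega>) * lerch_series \<omega> \<alpha> s = (1 - \<omega>) * h s"
          using lerch_series_recurrence[OF \<alpha> \<omega>, of s n] s False by (simp add: h_def g(2))
        thus ?thesis using False by simp
      qed
      ultimately show ?case by blast
    qed
    from this[of "Suc n"] show ?thesis by simp
  qed
  then obtain g where g: "\<And>c. poly_growth c g" "\<And>s. Re s > 1 \<Longrightarrow> g s = lerch_series \<omega> \<alpha> s"
    using poly_growth_glue[OF _ poly_growth_holomorphic[OF poly_growth_lerch_series[OF \<alpha> \<omega>]]] by blast
  \<comment> \<open>Here \<open>g\<close> itself continues the series; the factor is put in to reach
    the form shared with \<omega> = 1. It is written as a sum so that closure under addition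
    applies.\<close>
  have "poly_growth c (\<lambda>s. (s + (- 1)) * g s)" for c
    by (intro poly_growth_mult poly_growth_add poly_growth_ident poly_growth_const g)
  thus ?thesis using that[of "\<lambda>s. (s + (- 1)) * g s"] g(2) by simp
next
  case True
  define F where "F s = (s + (- 1)) * lerch_series \<omega> \<alpha> s" for s
  have F: "poly_growth 1 F"
    unfolding F_def by (intro poly_growth_mult poly_growth_add poly_growth_ident poly_growth_const poly_growth_lerch_series \<alpha> \<omega>)
  \<comment> \<open>For \<open>j \<ge> 2\<close> the last factor \<open>s + j - 1\<close> of the
    Pochhammer symbol turns the series at \<open>s + j\<close> into \<open>F (s + j)\<close>, so no
    division, and no new pole, arises.\<close>
  have rec: "F (s + 1) = of_real \<alpha> powr (-s) + lerch_rem \<omega> \<alpha> n s +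
      (\<Sum>j=2..n. ((-1) ^ j / fact j) * pochhammer s (j - 1) * F (s + of_nat j))"
    if s: "Re s > 1" and n: "n \<ge> 1" for s n
  proof -
    have "(\<Sum>j=1..n. (-1) ^ j * pochhammer s j / fact j * lerch_series \<omega> \<alpha> (s + of_nat j)) =
        - F (s + 1) + (\<Sum>j=2..n. (-1) ^ j * pochhammer s j / fact j * lerch_series \<omega> \<alpha> (s + of_nat j))"
      using n by (subst sum.atLeast_Suc_atMost) (auto simp: F_def numeral_2_eq_2)
    also have "(\<Sum>j=2..n. (-1) ^ j * pochhammer s j / fact j * lerch_series \<omega> \<alpha> (s + of_nat j)) =
      (\<Sum>j=2..n. ((-1) ^ j / fact j) * pochhammer s (j - 1) * F (s + of_nat j))"
    proof (rule sum.cong)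
      fix j assume "j \<in> {2..n}"
      then obtain i where "j = Suc i" by (cases j) auto
      thus "(-1) ^ j * pochhammer s j / fact j * lerch_series \<omega> \<alpha> (s + of_nat j) =
        ((-1) ^ j / fact j) * pochhammer s (j - 1) * F (s + of_nat j)"
        by (simp add: F_def pochhammer_Suc)
    qed auto
    finally have *: "(\<Sum>j=1..n. (-1) ^ j * pochhammer s j / fact j * lerch_series \<omega> \<alpha> (s + of_nat j)) =
      - F (s + 1) + (\<Sum>j=2..n. ((-1) ^ j / fact j) * pochhammer s (j - 1) * F (s + of_nat j))" .
    have "0 = of_real \<alpha> powr (-s) + lerch_rem \<omega> \<alpha> n s + (- F (s + 1) +
        (\<Sum>j=2..n. ((-1) ^ j / fact j) * pochhammer s (j - 1) * F (s + of_nat j)))"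
      using lerch_series_recurrence[OF \<alpha> \<omega> s, of n, unfolded *] True by simp
    thus ?thesis by algebra
  qed
  have "\<exists>g. poly_growth (- real n) g \<and> (\<forall>s. Re s > 2 \<longrightarrow> g s = F s)" for n
  proof -
    have "\<exists>g. poly_growth (1 - real n) g \<and> (\<forall>s. Re s > 2 \<longrightarrow> g s = F s)" for n
    proof (induction n)
      case 0
      show ?case using F by auto
    next
      case (Suc n)
      then obtain g where g: "poly_growth (1 - real n) g" "\<And>s. Re s > 2 \<Longrightarrow> g s = F s"
        by blast
      \<comment> \<open>All arguments of \<open>g\<close> are shifted by at least 2, so
        \<open>h\<close> reaches two units further left than \<open>g\<close>; one of them is lost
        again because \<open>h s\<close> represents \<open>F (s + 1)\<close>.\<close>
      define h where "h s = of_real \<alpha> powr (-s) + lerch_rem \<omega> \<alpha> (Suc n) s +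
        (\<Sum>j=2..Suc n. ((-1) ^ j / fact j) * pochhammer s (j - 1) * g (s + of_real (real j)))" for s
      have "poly_growth (- real (Suc n)) h"
        unfolding h_def
      proof (intro poly_growth_mult poly_growth_add poly_growth_const poly_growth_powr poly_growth_sum poly_growth_pochhammer \<alpha>)
        show "poly_growth (- real (Suc n)) (lerch_rem \<omega> \<alpha> (Suc n))"
          by (rule poly_growth_lerch_rem[OF \<alpha> \<omega>])
        fix j assume "j \<in> {2..Suc n}"
        thus "poly_growth (- real (Suc n)) (\<lambda>s. g (s + of_real (real j)))"
          by (intro poly_growth_mono[OF poly_growth_shift[OF g(1)]]) auto
      qed
      hence "poly_growth (1 - real (Suc n)) (\<lambda>s. h (s + of_real (- 1)))"
        using poly_growth_shift[of "- real (Suc n)" h "- 1"] by (simp add: add.commute)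
      moreover have "h (s + of_real (- 1)) = F s" if s: "Re s > 2" for s
        using rec[of "s - 1" "Suc n"] s by (simp add: h_def g(2))
      ultimately show ?case by blast
    qed
    from this[of "Suc n"] show ?thesis by simp
  qed
  then obtain g where "\<And>c. poly_growth c g" "\<And>s. Re s > 1 \<Longrightarrow> g s = F s"
    using poly_growth_glue[OF _ poly_growth_holomorphic[OF F]] by blast
  thus ?thesis using that[of g] by (simp add: F_def)
qed

section \<open>Identification of the continuation with \<open>lerch_zeta\<close>\<close>

text \<open>Off 1 the identity theorem applies, as the punctured plane is connected. At 1 a nicely
  meromorphic function takes its limit, or 0 at a pole, so its value there is determined by the
  values nearby.\<close>

lemma is_lerch_zeta_unique:
  fixes f g :: "complex \<Rightarrow> complex"
  assumes f: "f nicely_meromorphic_on UNIV" "\<And>z. is_pole f z \<Longrightarrow> z = 1"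
    and g: "g nicely_meromorphic_on UNIV" "\<And>z. is_pole g z \<Longrightarrow> z = 1"
    and eq: "\<And>s. Re s > 1 \<Longrightarrow> f s = g s"
  shows "f = g"
proof
  fix z
  have hol: "h holomorphic_on - {1}" if "h nicely_meromorphic_on UNIV" "\<And>z. is_pole h z \<Longrightarrow> z = 1" for h :: "complex \<Rightarrow> complex"
    using that nicely_meromorphic_on_imp_analytic_at[of h UNIV]
    by (intro analytic_imp_holomorphic) (auto simp: analytic_on_analytic_at[of _ "- {1}"])
  have off: "f w = g w" if "w \<noteq> 1" for w
  proof (rule analytic_continuation_open[of "{s. Re s > 1}" "- {1}" f g])
    have "complex_of_real 2 \<in> {s. Re s > 1}" by simp
    thus "{s. Re s > 1} \<noteq> {}" by blast
    show "connected (- {1::complex})" by (intro connected_punctured_universe) simp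
  qed (use that eq hol[OF f] hol[OF g] in \<open>auto intro: open_halfspace_Re_gt\<close>)
  hence ev: "eventually (\<lambda>w. f w = g w) (at 1)" by (auto simp: eventually_at_filter)
  show "f z = g z"
  proof (cases "z = 1")
    case True
    have "is_pole f 1 \<longleftrightarrow> is_pole g 1" by (rule is_pole_cong[OF ev refl])
    moreover have "f \<midarrow>1\<rightarrow> c \<longleftrightarrow> g \<midarrow>1\<rightarrow> c" for c by (rule tendsto_cong[OF ev])
    ultimately show ?thesis
      using f(1) g(1) True unfolding nicely_meromorphic_on_def
      by (metis UNIV_I at_neq_bot not_tendsto_and_filterlim_at_infinity is_pole_def tendsto_unique)
  qed (rule off)
qed

lemma lerch_zeta_exp_term:
  "exp (2 * of_real pi * \<i> * of_real lam * of_nat m) / of_real (real m + \<alpha>) powr s =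
     exp (2 * of_real pi * \<i> * of_real lam) ^ m * of_real (real m + \<alpha>) powr (-s)"
  by (simp add: exp_of_nat2_mult powr_minus_divide)

lemma norm_exp_lerch: "norm (exp (2 * complex_of_real pi * \<i> * of_real lam)) = 1"
  by (simp add: norm_exp_eq_Re)

text \<open>The definite description is resolved by exhibiting a witness and appealing to
  uniqueness; all later facts about \<open>lerch_zeta\<close> are read off from
  \<open>H\<close>.\<close>

lemma lerch_zeta_eq:
  assumes \<alpha>: "\<alpha> > 0" and H: "H holomorphic_on UNIV"
    and H1: "\<And>s. Re s > 1 \<Longrightarrow> H s = (s - 1) * lerch_series (exp (2 * of_real pi * \<i> * of_real lam)) \<alpha> s"
  shows lerch_zeta_eq_divide: "s \<noteq> 1 \<Longrightarrow> lerch_zeta lam \<alpha> s = H s / (s - 1)"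
    and not_is_pole_lerch_zeta: "s \<noteq> 1 \<Longrightarrow> \<not> is_pole (lerch_zeta lam \<alpha>) s"
    and analytic_at_lerch_zeta: "s \<noteq> 1 \<Longrightarrow> lerch_zeta lam \<alpha> analytic_on {s}"
proof -
  define q where "q s = H s / (s - 1)" for s
  define \<omega> where "\<omega> = exp (2 * complex_of_real pi * \<i> * of_real lam)"
  have Hana: "H analytic_on A" for A using H by (metis analytic_on_open analytic_on_subset open_UNIV subset_UNIV)
  have qana: "q analytic_on {s}" if "s \<noteq> 1" for s
    unfolding q_def using that by (intro analytic_intros Hana) auto
  have "q meromorphic_on UNIV"
    unfolding q_def by (intro meromorphic_intros analytic_on_imp_meromorphic_on Hana)
  \<comment> \<open>The plain quotient has value 0 at 1 by division by zero, which is wrong if the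
    singularity there is removable; \<open>remove_sings\<close> inserts the limit.\<close>
  hence nice: "remove_sings q nicely_meromorphic_on UNIV" by (rule remove_sings_nicely_meromorphic)
  have iso: "isolated_singularity_at q 1"
    using \<open>q meromorphic_on UNIV\<close> by (intro meromorphic_on_isolated_singularity) (auto intro: meromorphic_on_subset)
  have off: "remove_sings q s = q s" if "s \<noteq> 1" for s using qana[OF that] by simp
  have ana: "remove_sings q analytic_on {s}" if "s \<noteq> 1" for s
    using qana[OF that] by (rule remove_sings_analytic_on)
  have nopole: "\<not> is_pole (remove_sings q) s" if "s \<noteq> 1" for s
    using ana[OF that] by (rule analytic_at_imp_no_pole)
  have ord: "zorder (remove_sings q) 1 = -1" if "is_pole (remove_sings q) 1"
  proof -
    have pole: "is_pole q 1" using that iso by simp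
    \<comment> \<open>A zero of \<open>H\<close> at 1 would cancel the denominator, contradicting
      the pole; hence the pole is simple.\<close>
    have "H 1 \<noteq> 0"
    proof
      assume H0: "H 1 = 0"
      have "(\<lambda>x. if x = 1 then deriv H 1 else H x / (x - 1)) holomorphic_on UNIV"
        by (rule pole_theorem_open_0[OF H open_UNIV, of 1]) (use H0 in auto)
      hence "\<not> is_pole (\<lambda>x. if x = 1 then deriv H 1 else H x / (x - 1)) 1"
        using not_is_pole_holomorphic open_UNIV by blast
      moreover have "is_pole (\<lambda>x. if x = 1 then deriv H 1 else H x / (x - 1)) 1 \<longleftrightarrow> is_pole q 1"
        by (rule is_pole_cong) (auto simp: eventually_at_filter q_def)
      ultimately show False using pole by simp
    qed
    hence "zorder (\<lambda>s. H s / (s - 1) ^ 1) 1 = - 1"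
      using zorder_nonzero_div_power[OF open_UNIV _ H, of 1 1] by simp
    hence "zorder q 1 = -1" by (simp add: q_def[abs_def])
    thus ?thesis using iso by simp
  qed
  have series: "(\<lambda>m. exp (2 * of_real pi * \<i> * of_real lam * of_nat m) / of_real (real m + \<alpha>) powr s) sums remove_sings q s"
    if s: "Re s > 1" for s
  proof -
    have "(\<lambda>m. \<omega> ^ m * of_real (real m + \<alpha>) powr (-s)) sums lerch_series \<omega> \<alpha> s"
      unfolding lerch_series_def
      by (intro summable_sums summable_norm_cancel[OF summable_lerch_series[OF \<alpha> _ s]])
         (simp add: \<omega>_def norm_exp_lerch)
    moreover have "s \<noteq> 1" using s by auto
    moreover have "remove_sings q s = lerch_series \<omega> \<alpha> s"
      using off[OF \<open>s \<noteq> 1\<close>] H1[OF s] \<open>s \<noteq> 1\<close> by (simp add: q_def \<omega>_def)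
    ultimately show ?thesis by (simp only: lerch_zeta_exp_term \<omega>_def)
  qed
  have "lerch_zeta lam \<alpha> = remove_sings q"
    unfolding lerch_zeta_def
  proof (rule the_equality)
    show "remove_sings q nicely_meromorphic_on UNIV \<and>
     (\<forall>z. is_pole (remove_sings q) z \<longrightarrow> z = 1 \<and> zorder (remove_sings q) z = -1) \<and>
     (\<forall>s. Re s > 1 \<longrightarrow>
        (\<lambda>m. exp (2 * of_real pi * \<i> * of_real lam * of_nat m) / of_real (real m + \<alpha>) powr s)
          sums remove_sings q s)"
      by (intro conjI allI impI nice series) (use nopole ord in metis)+
    fix f assume f: "f nicely_meromorphic_on UNIV \<and>
     (\<forall>z. is_pole f z \<longrightarrow> z = 1 \<and> zorder f z = -1) \<and>
     (\<forall>s. Re s > 1 \<longrightarrow>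
        (\<lambda>m. exp (2 * of_real pi * \<i> * of_real lam * of_nat m) / of_real (real m + \<alpha>) powr s)
          sums f s)"
    show "f = remove_sings q"
    proof (rule is_lerch_zeta_unique)
      show "f s = remove_sings q s" if "Re s > 1" for s
        using f series[OF that] that sums_unique2 by blast
    qed (use f nice nopole in blast)+
  qed
  thus "s \<noteq> 1 \<Longrightarrow> lerch_zeta lam \<alpha> s = H s / (s - 1)"
    and "s \<noteq> 1 \<Longrightarrow> \<not> is_pole (lerch_zeta lam \<alpha>) s"
    and "s \<noteq> 1 \<Longrightarrow> lerch_zeta lam \<alpha> analytic_on {s}"
    using nopole off ana by (auto simp: q_def[abs_def])
qed

text \<open>The first term has modulus \<open>\<alpha> powr (- Re s) \<ge> 1\<close>. Since
  \<open>m + 1 + \<alpha> \<ge> \<alpha> * (m + 2)\<close>, this same factor can be pulled out of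
  the tail, which then is small compared with the first term even when \<alpha> is tiny.\<close>

lemma lerch_series_lower_bound:
  assumes \<alpha>: "0 < \<alpha>" "\<alpha> \<le> 1" and \<omega>: "norm \<omega> = 1"
  obtains \<sigma> where "\<sigma> \<ge> 2" "\<And>s. Re s \<ge> \<sigma> \<Longrightarrow> norm (lerch_series \<omega> \<alpha> s) \<ge> 1 / 2"
proof -
  define K where "K = (\<Sum>m. (real m + 2) powr (-2))"
  have smK: "summable (\<lambda>m. (real m + 2) powr (-2))" by (rule summable_shifted_powr) auto
  have K0: "K \<ge> 0" unfolding K_def by (intro suminf_nonneg smK) auto
  obtain N :: nat where N: "2 * (4 * K) < 2 ^ N" using real_arch_pow[of 2 "2 * (4 * K)"] by auto
  \<comment> \<open>Two units of the exponent pay for the convergent series \<open>K\<close>; the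
    other \<open>N\<close> give \<open>2 ^ N\<close>, chosen to outweigh \<open>K\<close>.\<close>
  define \<sigma> where "\<sigma> = real N + 2"
  show ?thesis
  proof (rule that)
    show "\<sigma> \<ge> 2" by (simp add: \<sigma>_def)
    fix s assume s: "Re s \<ge> \<sigma>"
    hence s1: "Re s > 1" by (simp add: \<sigma>_def)
    define T where "T m = \<omega> ^ m * of_real (real m + \<alpha>) powr (-s)" for m
    have nT: "norm (T m) = (real m + \<alpha>) powr (- Re s)" for m
      unfolding T_def norm_mult norm_power \<omega> using \<alpha> by (simp only: norm_of_real_powr add_nonneg_pos of_nat_0_le_iff uminus_complex.sel) simp
    have smT: "summable (\<lambda>m. norm (T m))"
      unfolding T_def by (rule summable_lerch_series) (use \<alpha> \<omega> s1 in auto)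
    hence smT1: "summable (\<lambda>m. norm (T (Suc m)))" by (subst summable_Suc_iff)
    define p where "p = \<alpha> powr (- Re s)"
    have p: "p \<ge> 1" unfolding p_def using \<alpha> s1 by (simp add: powr_minus one_le_inverse_iff powr_le1)
    have le: "norm (T (Suc m)) \<le> p * 2 powr (2 - Re s) * (real m + 2) powr (-2)" for m
    proof -
      have "\<alpha> * (real m + 2) \<le> real (Suc m) + \<alpha>"
        using \<alpha> mult_right_mono[of \<alpha> 1 "real m + 1"] by (simp add: algebra_simps)
      hence "norm (T (Suc m)) \<le> (\<alpha> * (real m + 2)) powr (- Re s)"
        unfolding nT using \<alpha> s1 by (intro powr_mono2') auto
      also have "\<dots> = p * ((real m + 2) powr (2 - Re s) * (real m + 2) powr (-2))"
        using \<alpha> by (simp add: p_def powr_mult flip: powr_add)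
      also have "\<dots> \<le> p * (2 powr (2 - Re s) * (real m + 2) powr (-2))"
        using p s by (intro mult_left_mono mult_right_mono powr_mono2') (auto simp: \<sigma>_def)
      finally show ?thesis by (simp add: mult_ac)
    qed
    have "norm (\<Sum>m. T (Suc m)) \<le> (\<Sum>m. norm (T (Suc m)))" by (rule summable_norm[OF smT1])
    also have "\<dots> \<le> (\<Sum>m. p * 2 powr (2 - Re s) * (real m + 2) powr (-2))"
      by (intro suminf_le smT1 summable_mult smK le)
    also have "\<dots> = p * 2 powr (2 - Re s) * K" unfolding K_def by (rule suminf_mult[OF smK])
    also have "\<dots> \<le> p * (1 / 2)"
    proof -
      have "2 powr (2 - Re s) \<le> 2 powr (- real N)" using s by (intro powr_mono) (auto simp: \<sigma>_def)
      also have "\<dots> = 1 / 2 ^ N" by (simp add: powr_minus powr_realpow divide_inverse)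
      finally have "2 powr (2 - Re s) * K \<le> 1 / 2 ^ N * K" using K0 by (rule mult_right_mono)
      also have "\<dots> \<le> 1 / 2" using N K0 by (simp add: field_simps)
      finally show ?thesis using p mult_left_mono[of "2 powr (2 - Re s) * K" "1/2" p] by (simp add: mult.assoc)
    qed
    finally have "norm (\<Sum>m. T (Suc m)) \<le> p / 2" by simp
    moreover have "lerch_series \<omega> \<alpha> s = T 0 + (\<Sum>m. T (Suc m))"
      unfolding lerch_series_def using suminf_split_head[OF summable_norm_cancel[OF smT]] by (simp add: T_def)
    moreover have "norm (T 0) = p" by (simp add: nT p_def)
    moreover have "norm (T 0) \<le> norm (T 0 + (\<Sum>m. T (Suc m))) + norm (\<Sum>m. T (Suc m))"
      using norm_triangle_ineq4[of "T 0 + (\<Sum>m. T (Suc m))" "\<Sum>m. T (Suc m)"] by simp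
    ultimately show "norm (lerch_series \<omega> \<alpha> s) \<ge> 1 / 2" using p by simp
  qed
qed

subsection \<open>The lower bound for the Lerch zeta function\<close>

text \<open>Continuity keeps a whole disc about \<open>s\<close> free of zeros, so the logarithm of
  the distance is taken of a positive number whenever zeros exist.\<close>

lemma infdist_lerch_zeros_pos:
  assumes "lerch_zeta lam \<alpha> analytic_on {s}" "lerch_zeta lam \<alpha> s \<noteq> 0" "lerch_zeros lam \<alpha> \<noteq> {}"
  shows "infdist s (lerch_zeros lam \<alpha>) > 0"
proof -
  have "isCont (lerch_zeta lam \<alpha>) s" using assms(1) by (rule analytic_at_imp_isCont)
  then obtain e where e: "e > 0" "\<And>y. dist s y < e \<Longrightarrow> lerch_zeta lam \<alpha> y \<noteq> 0"
    using continuous_at_avoid[of s "lerch_zeta lam \<alpha>" 0] assms(2) by auto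
  have "e \<le> infdist s (lerch_zeros lam \<alpha>)"
    unfolding infdist_notempty[OF assms(3)]
    by (rule cINF_greatest[OF assms(3)]) (use e(2) in \<open>force simp: lerch_zeros_def not_less\<close>)
  with e(1) show ?thesis by linarith
qed

theorem proposition2:
  fixes lam \<alpha> \<sigma>\<^sub>0 t\<^sub>0 :: real
  assumes "0 < lam" and "lam \<le> 1" and "0 < \<alpha>" and "\<alpha> \<le> 1" and "1 < t\<^sub>0"
  shows "\<exists>C::real. C > 0 \<and>
    (\<forall>s. Re s \<ge> \<sigma>\<^sub>0 \<longrightarrow> Im s \<ge> t\<^sub>0 \<longrightarrow> lerch_zeta lam \<alpha> s \<noteq> 0 \<longrightarrow>
       1 / cmod (lerch_zeta lam \<alpha> s)
         < exp (C * (\<bar>ln (infdist s (lerch_zeros lam \<alpha>))\<bar> + 1) * ln (Im s)))"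
proof -
  define \<omega> where "\<omega> = exp (2 * complex_of_real pi * \<i> * of_real lam)"
  have \<omega>: "norm \<omega> = 1" by (simp add: \<omega>_def norm_exp_lerch)
  obtain H where H: "\<And>c. poly_growth c H" "\<And>s. Re s > 1 \<Longrightarrow> H s = (s - 1) * lerch_series \<omega> \<alpha> s"
    using lerch_series_continuation[of \<alpha> \<omega>] assms(3) \<omega> by auto
  obtain \<sigma>' where \<sigma>': "\<sigma>' \<ge> 2" "\<And>s. Re s \<ge> \<sigma>' \<Longrightarrow> norm (lerch_series \<omega> \<alpha> s) \<ge> 1 / 2"
    using lerch_series_lower_bound[OF assms(3,4) \<omega>] by blast
  have holH: "H holomorphic_on UNIV"
    unfolding holomorphic_on_def
  proof
    fix z
    have "H holomorphic_on {s. Re s > Re z - 1}" by (rule poly_growth_holomorphic[OF H(1)])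
    hence "H field_differentiable at z"
      by (rule holomorphic_on_imp_differentiable_at) (auto intro: open_halfspace_Re_gt)
    thus "H field_differentiable at z within UNIV" by simp
  qed
  have L: "lerch_zeta lam \<alpha> s = H s / (s - 1)" "\<not> is_pole (lerch_zeta lam \<alpha>) s"
      "lerch_zeta lam \<alpha> analytic_on {s}" if "s \<noteq> 1" for s
    using lerch_zeta_eq[OF assms(3) holH _ that] H(2) by (simp_all add: \<omega>_def)
  \<comment> \<open>The real part of the centres: far enough right for the first term to dominate,
    and not left of \<open>\<sigma>\<^sub>0\<close>. The radius \<open>R\<close> below then reaches
    every \<open>s\<close> at the same height with
    \<open>\<sigma>\<^sub>0 \<le> Re s < \<sigma>\<^sub>1\<close>; the added 1 ensures
    \<open>R \<ge> 1\<close>.\<close>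
  define \<sigma>\<^sub>1 where "\<sigma>\<^sub>1 = max \<sigma>' \<sigma>\<^sub>0"
  define R where "R = \<sigma>\<^sub>1 - \<sigma>\<^sub>0 + 1"
  have R: "R \<ge> 1" "\<sigma>\<^sub>1 \<ge> 2" using \<sigma>'(1) by (auto simp: R_def \<sigma>\<^sub>1_def)
  obtain A n where A: "A \<ge> 0"
    "\<And>s. \<sigma>\<^sub>1 - 5 * R \<le> Re s \<Longrightarrow> Re s \<le> \<sigma>\<^sub>1 + 5 * R \<Longrightarrow> norm (H s) \<le> A * (1 + norm s) ^ n"
    using poly_growthE[OF H(1)[of "\<sigma>\<^sub>1 - 5 * R - 1"], of "\<sigma>\<^sub>1 - 5 * R" "\<sigma>\<^sub>1 + 5 * R"] by auto
  define K where "K = 2 + \<sigma>\<^sub>1 + 5 * R"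
  have K: "K \<ge> 1" using R by (simp add: K_def)
  \<comment> \<open>Chosen so that \<open>B * t ^ n\<close> bounds the quotient of \<open>H\<close>
    by its value at the centre: the 2 pays for \<open>norm (H z0) \<ge> 1 / 2\<close>, and
    \<open>A + 1\<close> in place of \<open>A\<close> makes \<open>B > 1\<close>.\<close>
  define B where "B = 2 * (A + 1) * K ^ n"
  have B: "B > 1"
  proof -
    have "1 * 1 \<le> (A + 1) * K ^ n" using A(1) K by (intro mult_mono) auto
    hence "1 < 2 * ((A + 1) * K ^ n)" by linarith
    thus ?thesis by (simp only: B_def mult.assoc)
  qed
  \<comment> \<open>A positive lower bound for \<open>ln t\<close>, which turns every additive
    constant \<open>x\<close> into the multiple \<open>x / l\<^sub>0 * ln t\<close>. Below,
    \<open>c\<^sub>1\<close> bounds \<open>ln M\<close> and \<open>c\<^sub>2\<close> the number of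
    removed zeros, both in units of \<open>ln t\<close>.\<close>
  define l\<^sub>0 where "l\<^sub>0 = ln t\<^sub>0"
  have l\<^sub>0: "l\<^sub>0 > 0" using assms(5) by (simp add: l\<^sub>0_def)
  define c\<^sub>1 where "c\<^sub>1 = ln B / l\<^sub>0 + real n"
  define c\<^sub>2 where "c\<^sub>2 = c\<^sub>1 / ln (3 / 2)"
  have c: "c\<^sub>1 \<ge> 0" "c\<^sub>2 \<ge> 0" using B l\<^sub>0 by (auto simp: c\<^sub>1_def c\<^sub>2_def)
  \<comment> \<open>The first summand serves \<open>Re s \<ge> \<sigma>\<^sub>1\<close>, the bracket
    serves the disc argument, and the final 1 makes the inequalities strict.\<close>
  define C where "C = ln 2 / l\<^sub>0 + (ln (2 * K) / l\<^sub>0 + 1 + 4 * c\<^sub>1 + c\<^sub>2 * (ln (2 * R) + 1)) + 1"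
  have lnK: "ln (2 * K) \<ge> 0" "ln (2 * R) \<ge> 0" using K R by auto
  have C: "C \<ge> ln 2 / l\<^sub>0 + 1" "C > ln (2 * K) / l\<^sub>0 + 1 + 4 * c\<^sub>1 + c\<^sub>2 * (ln (2 * R) + 1)"
    using lnK c l\<^sub>0 by (auto simp: C_def intro!: add_nonneg_nonneg mult_nonneg_nonneg divide_nonneg_nonneg add_nonneg_pos)
  have C0: "C > 0" using C(1) l\<^sub>0 by (smt (verit) divide_nonneg_pos ln_ge_zero)
  have const_le: "x \<le> x / l\<^sub>0 * l" if "x \<ge> 0" "l \<ge> l\<^sub>0" for x l
    using that l\<^sub>0 mult_left_mono[of l\<^sub>0 l "x / l\<^sub>0"] by simp
  show ?thesis
  proof (intro exI[of _ C] conjI C0 allI impI)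
    fix s assume s: "Re s \<ge> \<sigma>\<^sub>0" "Im s \<ge> t\<^sub>0" "lerch_zeta lam \<alpha> s \<noteq> 0"
    define t where "t = Im s"
    define l where "l = ln t"
    have t: "t > 1" using s assms(5) by (simp add: t_def)
    have l: "l \<ge> l\<^sub>0" "l > 0" using s assms(5) l\<^sub>0 by (auto simp: l_def l\<^sub>0_def t_def)
    have s1: "s \<noteq> 1" using t by (auto simp: t_def)
    define Z where "Z = lerch_zeros lam \<alpha>"
    define D where "D = \<bar>ln (infdist s Z)\<bar>"
    have D: "D \<ge> 0" by (simp add: D_def)
    have "1 / cmod (lerch_zeta lam \<alpha> s) < exp (C * (D + 1) * l)"
    proof (cases "Re s \<ge> \<sigma>\<^sub>1")
      case True
      have "Re s > 1" using True R by simp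
      have "lerch_zeta lam \<alpha> s = lerch_series \<omega> \<alpha> s"
        using L(1)[OF s1] H(2)[OF \<open>Re s > 1\<close>] s1 by simp
      hence "1 / 2 \<le> cmod (lerch_zeta lam \<alpha> s)"
        using \<sigma>'(2)[of s] True by (simp add: \<sigma>\<^sub>1_def)
      hence "1 / cmod (lerch_zeta lam \<alpha> s) \<le> 1 / (1 / 2)" by (intro divide_left_mono) auto
      also have "1 / (1 / 2) = exp (ln (2::real))" by simp
      also have "ln 2 < C * (D + 1) * l"
      proof -
        have "ln 2 \<le> ln 2 / l\<^sub>0 * l" using l by (intro const_le) auto
        also have "\<dots> < C * l" using C(1) l(2) by (intro mult_strict_right_mono) auto
        also have "\<dots> \<le> C * (D + 1) * l" using C0 D l(2) by simp
        finally show ?thesis .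
      qed
      finally show ?thesis by simp
    next
      case False
      define z0 where "z0 = Complex \<sigma>\<^sub>1 t"
      have Kt: "1 + norm w \<le> K * t" if "w \<in> cball z0 (5 * R)" for w
      proof -
        have "norm w \<le> norm z0 + 5 * R"
          using that norm_triangle_ineq2[of w z0] by (simp add: dist_norm norm_minus_commute)
        also have "norm z0 \<le> \<sigma>\<^sub>1 + t"
          using cmod_le[of z0] R t by (simp add: z0_def)
        finally have "1 + norm w \<le> t + (1 + \<sigma>\<^sub>1 + 5 * R) * 1" by simp
        also have "\<dots> \<le> t + (1 + \<sigma>\<^sub>1 + 5 * R) * t" using R t by (intro add_left_mono mult_left_mono) auto
        finally show ?thesis by (simp add: K_def algebra_simps)
      qed
      have sz: "s \<in> cball z0 R"
      proof -
        have "z0 - s = of_real (\<sigma>\<^sub>1 - Re s)" by (simp add: z0_def t_def complex_eq_iff)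
        hence "norm (z0 - s) = \<sigma>\<^sub>1 - Re s" using False by (simp only: norm_of_real)
        thus ?thesis using s(1) by (simp add: dist_norm R_def)
      qed
      define M where "M = B * t ^ n"
      have M1: "M > 1"
        unfolding M_def using B t one_le_power[of t n] by (smt (verit) mult_le_cancel_left1)
      have Hz0: "norm (H z0) \<ge> 1 / 2"
      proof -
        have "norm (lerch_series \<omega> \<alpha> z0) \<ge> 1 / 2" by (rule \<sigma>'(2)) (simp add: z0_def \<sigma>\<^sub>1_def)
        moreover have "norm (z0 - 1) \<ge> 1" using abs_Re_le_cmod[of "z0 - 1"] R by (simp add: z0_def)
        ultimately have "1 * (1 / 2) \<le> norm (z0 - 1) * norm (lerch_series \<omega> \<alpha> z0)"
          by (intro mult_mono) auto
        thus ?thesis using H(2)[of z0] R by (simp add: z0_def norm_mult)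
      qed
      have HM: "norm (H w) \<le> M * norm (H z0)" if w: "w \<in> cball z0 (5 * R)" for w
      proof -
        have "\<bar>Re w - \<sigma>\<^sub>1\<bar> \<le> 5 * R"
          using abs_Re_le_cmod[of "w - z0"] w by (simp add: z0_def dist_norm norm_minus_commute)
        hence "norm (H w) \<le> A * (1 + norm w) ^ n" by (intro A(2)) auto
        also have "\<dots> \<le> (A + 1) * (K * t) ^ n"
          using A(1) Kt[OF w] by (intro mult_mono power_mono) auto
        also have "\<dots> = M * (1 / 2)" by (simp add: M_def B_def power_mult_distrib)
        also have "\<dots> \<le> M * norm (H z0)" using Hz0 M1 by (intro mult_left_mono) auto
        finally show ?thesis .
      qed
      \<comment> \<open>Cutting off at 1 gives \<open>0 \<le> - ln \<delta> \<le> D\<close> even for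
        distances above 1. Without zeros \<open>infdist\<close> is 0 by convention and carries no
        information, and \<open>\<delta> = 1\<close> needs only \<open>D \<ge> 0\<close>.\<close>
      define \<delta> where "\<delta> = (if Z = {} then 1 else min (infdist s Z) 1)"
      have \<delta>: "\<delta> > 0" "\<delta> \<le> 1" "- ln \<delta> \<le> D"
        using infdist_lerch_zeros_pos[OF L(3)[OF s1] s(3)]
        by (auto simp: \<delta>_def Z_def D_def min_def)
      \<comment> \<open>A zero of \<open>H\<close> at 1 need not be a zero of the Lerch zeta
        function, but \<open>s\<close> is further than \<open>t > 1\<close> or exactly
        \<open>t\<close> away from it, hence at least \<delta>.\<close>
      have far: "\<delta> \<le> dist s r" if r: "H r = 0" for r
      proof (cases "r = 1")
        case True
        have "\<delta> \<le> t" using \<delta> t by simp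
        also have "t \<le> norm (s - 1)" using abs_Im_le_cmod[of "s - 1"] by (simp add: t_def)
        finally show ?thesis using True by (simp add: dist_norm)
      next
        case False
        hence "r \<in> Z" using L(1,2)[of r] r by (simp add: Z_def lerch_zeros_def)
        thus ?thesis using infdist_le[of r Z s] by (auto simp: \<delta>_def)
      qed
      have "H z0 \<noteq> 0" using Hz0 by auto
      obtain m where m: "(3/2) ^ m \<le> M" "norm (H z0) * \<delta> ^ m \<le> M ^ 4 * (2 * R) ^ m * norm (H s)"
        using holomorphic_lower_bound[of UNIV z0 R H M s \<delta>, OF _ _ holH _ M1 \<open>H z0 \<noteq> 0\<close> HM sz] \<delta> R far
        by auto
      have "norm (s - 1) \<le> K * t"
        using Kt[of s] sz R norm_triangle_ineq4[of s 1] by auto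
      have Hs: "norm (H s) > 0" using L(1)[OF s1] s(3) by auto
      have "1 / cmod (lerch_zeta lam \<alpha> s) = norm (s - 1) / norm (H s)"
        using L(1)[OF s1] by (simp add: norm_divide)
      also have "\<dots> \<le> (K * t) * (2 * (M ^ 4 * (2 * R) ^ m) / \<delta> ^ m)"
      proof -
        have "1 / 2 * \<delta> ^ m \<le> norm (H z0) * \<delta> ^ m" using Hz0 \<delta> by (intro mult_right_mono) auto
        with m(2) have "\<delta> ^ m \<le> 2 * (M ^ 4 * (2 * R) ^ m) * norm (H s)" by simp
        hence "1 / norm (H s) \<le> 2 * (M ^ 4 * (2 * R) ^ m) / \<delta> ^ m"
          using Hs \<delta> by (simp add: field_simps)
        with \<open>norm (s - 1) \<le> K * t\<close> have "norm (s - 1) * (1 / norm (H s)) \<le> (K * t) * (2 * (M ^ 4 * (2 * R) ^ m) / \<delta> ^ m)"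
          using K t by (intro mult_mono) auto
        thus ?thesis by simp
      qed
      also have "\<dots> = exp (ln (2 * K) + l + 4 * ln M + real m * (ln (2 * R) - ln \<delta>))"
      proof -
        have "exp (4 * ln M) = M ^ 4" using M1 exp_of_nat_mult[of 4 "ln M"] by simp
        moreover have "exp (real m * (ln (2 * R) - ln \<delta>)) = (2 * R / \<delta>) ^ m"
          using R \<delta> by (simp add: exp_of_nat_mult exp_diff)
        ultimately show ?thesis using K t by (simp add: exp_add l_def power_divide)
      qed
      also have "\<dots> < exp (C * (D + 1) * l)"
      proof -
        have "ln M = ln B + real n * l" using B t by (simp add: M_def l_def ln_mult ln_realpow)
        also have "\<dots> \<le> ln B / l\<^sub>0 * l + real n * l" using B l by (intro add_right_mono const_le) auto
        finally have lnM: "ln M \<le> c\<^sub>1 * l" by (simp add: c\<^sub>1_def distrib_right)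
        have "real m * ln (3 / 2) = ln ((3 / 2) ^ m)" by (simp add: ln_realpow)
        also have "\<dots> \<le> ln M" using m(1) M1 by (intro ln_mono) auto
        finally have "real m \<le> ln M / ln (3 / 2)" by (simp add: field_simps)
        also have "\<dots> \<le> c\<^sub>1 * l / ln (3 / 2)" using lnM by (intro divide_right_mono) auto
        finally have m: "real m \<le> c\<^sub>2 * l" by (simp add: c\<^sub>2_def)
        \<comment> \<open>The only product of two unbounded quantities: the zero count contributes
          \<open>ln t\<close> and the cost per zero contributes \<open>D\<close>, which produces the
          shape \<open>(D + 1) * ln t\<close> of the exponent.\<close>
        have "real m * (ln (2 * R) - ln \<delta>) \<le> (c\<^sub>2 * l) * (ln (2 * R) + D)"
          using m \<delta> lnK l c D ln_le_zero_iff[of \<delta>] by (intro mult_mono) (auto simp del: ln_le_zero_iff)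
        also have "\<dots> \<le> (c\<^sub>2 * l) * ((ln (2 * R) + 1) * (D + 1))"
        proof (intro mult_left_mono)
          have "0 \<le> ln (2 * R) * D" using lnK D by simp
          thus "ln (2 * R) + D \<le> (ln (2 * R) + 1) * (D + 1)" by (simp add: algebra_simps)
        qed (use c l in auto)
        finally have 1: "real m * (ln (2 * R) - ln \<delta>) \<le> c\<^sub>2 * (ln (2 * R) + 1) * ((D + 1) * l)" by (simp add: mult_ac)
        have "ln (2 * K) + l + 4 * ln M \<le> (ln (2 * K) / l\<^sub>0 + 1 + 4 * c\<^sub>1) * l"
          using const_le[OF lnK(1) l(1)] lnM by (simp add: algebra_simps)
        also have "\<dots> \<le> (ln (2 * K) / l\<^sub>0 + 1 + 4 * c\<^sub>1) * ((D + 1) * l)"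
          using D l lnK c l\<^sub>0 by (intro mult_left_mono) auto
        finally have "ln (2 * K) + l + 4 * ln M + real m * (ln (2 * R) - ln \<delta>) \<le>
            (ln (2 * K) / l\<^sub>0 + 1 + 4 * c\<^sub>1 + c\<^sub>2 * (ln (2 * R) + 1)) * ((D + 1) * l)"
          using 1 unfolding distrib_right by linarith
        also have "\<dots> < C * ((D + 1) * l)" using C(2) D l by (intro mult_strict_right_mono) auto
        finally show ?thesis by (simp add: mult_ac)
      qed
      finally show ?thesis .
    qed
    thus "1 / cmod (lerch_zeta lam \<alpha> s) < exp (C * (\<bar>ln (infdist s (lerch_zeros lam \<alpha>))\<bar> + 1) * ln (Im s))"
      by (simp add: D_def Z_def l_def t_def)
  qed
qed

end
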